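(* Let $R$ be a non-zero ring with identity (not necessarily commutative), let $n\ge1$, and let $f(Z)=Z^n+b_{n-1}Z^{n-1}+\cdots+b_1Z+b_0\in R[Z]$ with $b_0,\dots,b_{n-1}$ central in $R$. Let $R_f$ be the universal splitting ring for $f$ over $R$, with $r_1,\dots,r_n\in R_f$, and let $A_1,\dots,A_n\in M_{n!}(R)$ be the matrices of the right $R$-linear operators $\ell_{r_1},\dots,\ell_{r_n}$ of $R_f$ (left multiplications by $r_1,\dots,r_n$) relative to the $R$-basis $r_1^{\alpha_1}\cdots r_n^{\alpha_n}$, $0\le\alpha_i\le n-i$, ordered as described in the context. Then $A_1,\dots,A_n$ can be recursively constructed as follows. (1) $A_1=C_f\oplus\cdots\oplus C_f$ ($(n-1)!$ summands), where $C_f\in M_n(R)$ is the companion matrix of $f$. (2) In particular, if $n=1$ then $A_1=(-b_0)$. (3) Suppose $n>1$. Let $S=R[r_1]$ and let $B_2,\dots,B_n\in M_{(n-1)!}(S)$ be the matrices of the right $S$-linear operators $\ell_{r_2},\dots,\ell_{r_n}$ of $R_f=S_g$ relative to the $S$-basis $r_2^{\alpha_2}\cdots r_n^{\alpha_n}$, $0\le\alpha_i\le n-i$, with the inherited order, where $g(Z)=\frac{f(Z)-f(r_1)}{Z-r_1}\in S[Z]$. Then every entry of each $B_i$ is of the form $\pm f^{[j]}(r_1)$ for some $j\ge0$, and for each $2\le i\le n$ the matrix $A_i$ is obtained from $B_i$ by replacing each entry $\pm f^{[j]}(r_1)\in S$ by the block $\pm f^{[j]}(C_f)\in M_n(R)$.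 Here $f^{[j]}(C_f)$ is explicitly given as follows, with $b_n=1$: $f^{[j]}(C_f)=0$ for $j\ge n$; for $0\le j\le n-1$, the entry of $f^{[j]}(C_f)$ in row $r$ and column $c$ is, when $c\le j+1$, equal to $b_{j+1+r-c}$ if $c\le r\le n-1-j+c$ and $0$ otherwise, and, when $c\ge j+2$, equal to $-b_{r-c+1+j}$ if $c-1-j\le r\le c-1$ and $0$ otherwise. (4) In particular, every non-zero entry of $A_1,\dots,A_n$ is equal to a coefficient of $f$, up to a sign.
   Context: In polynomial rings the variables commute with each other and with the coefficients. Writing $f(Z)=Z^n-a_1Z^{n-1}+\cdots+(-1)^na_n$ (so $b_{n-k}=(-1)^ka_k$), the universal splitting ring for $f$ over $R$ is $R_f=R[X_1,\dots,X_n]/I_f$, where $I_f$ is the two-sided ideal generated by $\sigma_1-a_1,\dots,\sigma_n-a_n$ ($\sigma_i$ the elementary symmetric polynomials), and $r_i=X_i+I_f$. As the coefficients are central, $R$ embeds in $R_f$ and $R_f$ is a free right $R$-module with basis $r_1^{\alpha_1}\cdots r_n^{\alpha_n}$, $0\le\alpha_i\le n-i$. For $u\in R_f$, $\ell_u$ denotes left multiplication by $u$ on $R_f$; the columns of the matrix of an operator are the coordinates of the images of the basis vectors. Order of the basis: for $n=1$ there is only one basis element. For $n>1$, let $s_1$ be the sequence $1,r_1,\dots,r_1^{n-1}$; let $s_2$ be the concatenation $s_1,s_1r_2,\dots,s_1r_2^{n-2}$ (where $s_1r_2^k$ is the sequence $s_1$ multiplied termwise by $r_2^k$); let $s_3$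 be $s_2,s_2r_3,\dots,s_2r_3^{n-3}$; and so on. The basis is ordered according to $s_{n-1}$. For $n>1$, with $S=R[r_1]\subseteq R_f$, $R_f$ is a free right $S$-module with basis $r_2^{\alpha_2}\cdots r_n^{\alpha_n}$, $0\le\alpha_i\le n-i$, ordered by the inherited order, that is, the order in which these elements occur in the sequence $s_{n-1}$; $g(Z)=\frac{f(Z)-f(r_1)}{Z-r_1}\in S[Z]$ is monic of degree $n-1$ with coefficients central in $S$, and $R_f=S_g$ is (identified with) the universal splitting ring for $g$ over $S$, with $r_2,\dots,r_n$ in the roles of the universal roots. $C_f\in M_n(R)$ is the companion matrix having entries $1$ on the subdiagonal, last column $(-b_0,-b_1,\dots,-b_{n-1})^T$, and zeros elsewhere (for $n=1$, $C_f=(-b_0)$). For a polynomial $p\in R[Z]$ define $p^{[0]}(Z)=\frac{p(Z)-p(0)}{Z}$ and $p^{[j+1]}(Z)=\frac{p^{[j]}(Z)-p^{[j]}(0)}{Z}$ for $j\ge0$; thus $f^{[j]}(Z)=Z^{n-1-j}+b_{n-1}Z^{n-2-j}+\cdots+b_{j+1}$ for $0\le j\le n-1$ and $f^{[j]}=0$ for $j\ge n$. For $p=\sum c_kZ^k\in R[Z]$, $p(C_f)=\sum c_kC_f^k$. *)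

theory Defs
  imports
    "HOL-Algebra.Generated_Rings"
    "HOL-Algebra.QuotRing"
    "HOL-Library.Poly_Mapping"
    "HOL-Library.FuncSet"
    "HOL-Computational_Algebra.Polynomial"
    "Jordan_Normal_Form.Matrix"
begin

text \<open>
  The coefficient ring is a type \<open>'a :: ring_1\<close>: not necessarily commutative, and non-zero because
  \<open>0 \<noteq> 1\<close> belongs to the class.  The splitting ring depends on the polynomial, so it is not a type
  but a ring of HOL-Algebra.
\<close>


section \<open>The universal splitting ring\<close>

text \<open>
  An element of type \<open>(nat \<Rightarrow>\<^sub>0 nat) \<Rightarrow>\<^sub>0 'a\<close> maps monomials (exponent vectors) to coefficients; its
  product is convolution, so the variables commute with each other and with the coefficients.
\<close>

definition mpoly_ring :: "nat \<Rightarrow> ((nat \<Rightarrow>\<^sub>0 nat) \<Rightarrow>\<^sub>0 'a::ring_1) ring" where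
  "mpoly_ring n =
     \<lparr>carrier = {p. \<forall>m \<in> Poly_Mapping.keys p. Poly_Mapping.keys m \<subseteq> {1..n}}, monoid.mult = (*), one = 1, zero = 0, add = (+)\<rparr>"

definition mconst :: "'a \<Rightarrow> ((nat \<Rightarrow>\<^sub>0 nat) \<Rightarrow>\<^sub>0 'a::ring_1)" where
  "mconst a = Poly_Mapping.single 0 a"

definition mvar :: "nat \<Rightarrow> ((nat \<Rightarrow>\<^sub>0 nat) \<Rightarrow>\<^sub>0 'a::ring_1)" where
  "mvar i = Poly_Mapping.single (Poly_Mapping.single i 1) 1"

text \<open>
  The summand belonging to \<open>A\<close> is the monomial \<open>\<Prod>i\<in>A. X i\<close>.  It is written as an exponent
  vector because \<open>prod\<close> is not available over a non-commutative coefficient type.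
\<close>
definition elem_sym :: "nat \<Rightarrow> nat \<Rightarrow> ((nat \<Rightarrow>\<^sub>0 nat) \<Rightarrow>\<^sub>0 'a::ring_1)" where
  "elem_sym n k = (\<Sum>A | A \<subseteq> {1..n} \<and> card A = k.
      Poly_Mapping.single (\<Sum>i\<in>A. Poly_Mapping.single i 1) 1)"

text \<open>
  With \<open>f = Z^n - a\<^sub>1 Z^(n-1) + \<dots> + (-1)^n a\<^sub>n\<close> we have \<open>a\<^sub>k = (-1)^k b\<^sub>n\<^sub>-\<^sub>k\<close>.  Ideals of HOL-Algebra are
  two-sided.
\<close>
definition split_ideal :: "nat \<Rightarrow> 'a::ring_1 poly \<Rightarrow> ((nat \<Rightarrow>\<^sub>0 nat) \<Rightarrow>\<^sub>0 'a) set" where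
  "split_ideal n f = genideal (mpoly_ring n)
     {elem_sym n k - mconst ((-1) ^ k * Polynomial.coeff f (n - k)) |k. k \<in> {1..n}}"

definition split_ring ::
  "nat \<Rightarrow> 'a::ring_1 poly \<Rightarrow> ((nat \<Rightarrow>\<^sub>0 nat) \<Rightarrow>\<^sub>0 'a) set ring" where
  "split_ring n f = mpoly_ring n Quot split_ideal n f"

definition split_root ::
  "nat \<Rightarrow> 'a::ring_1 poly \<Rightarrow> nat \<Rightarrow> ((nat \<Rightarrow>\<^sub>0 nat) \<Rightarrow>\<^sub>0 'a) set" where
  "split_root n f i = split_ideal n f +>\<^bsub>mpoly_ring n\<^esub> mvar i"

definition emb ::
  "nat \<Rightarrow> 'a::ring_1 poly \<Rightarrow> 'a \<Rightarrow> ((nat \<Rightarrow>\<^sub>0 nat) \<Rightarrow>\<^sub>0 'a) set" where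
  "emb n f a = split_ideal n f +>\<^bsub>mpoly_ring n\<^esub> mconst a"


section \<open>Matrices of left multiplications\<close>

text \<open>
  \<open>T\<close> is viewed as a right module over \<open>K\<close> via the embedding \<open>h\<close>, with basis \<open>bs\<close>.  Indices of lists
  and of matrices start at 0.
\<close>

definition coords ::
  "('t, 'm) ring_scheme \<Rightarrow> 'k set \<Rightarrow> ('k \<Rightarrow> 't) \<Rightarrow> 't list \<Rightarrow> 't \<Rightarrow> nat \<Rightarrow> 'k" where
  "coords T K h bs x = (THE c. c \<in> {..<length bs} \<rightarrow>\<^sub>E K \<and>
      x = (\<Oplus>\<^bsub>T\<^esub>j\<in>{..<length bs}. bs ! j \<otimes>\<^bsub>T\<^esub> h (c j)))"

definition left_mult_mat ::
  "('t, 'm) ring_scheme \<Rightarrow> 'k set \<Rightarrow> ('k \<Rightarrow> 't) \<Rightarrow> 't list \<Rightarrow> 't \<Rightarrow> 'k mat" where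
  "left_mult_mat T K h bs u = mat (length bs) (length bs)
      (\<lambda>(r, c). coords T K h bs (u \<otimes>\<^bsub>T\<^esub> bs ! c) r)"

text \<open>
  The sequences \<open>s\<^sub>k\<close>; starting from \<open>s\<^sub>0 = [1]\<close> gives \<open>s\<^sub>1 = [1, r\<^sub>1, \<dots>, r\<^sub>1^(n-1)]\<close>, and makes
  \<open>s\<^sub>n\<^sub>-\<^sub>1\<close> the one-element basis when \<open>n = 1\<close>.
\<close>
primrec basis_seq ::
  "nat \<Rightarrow> 'a::ring_1 poly \<Rightarrow> nat \<Rightarrow> ((nat \<Rightarrow>\<^sub>0 nat) \<Rightarrow>\<^sub>0 'a) set list" where
  "basis_seq n f 0 = [\<one>\<^bsub>split_ring n f\<^esub>]"
| "basis_seq n f (Suc k) = concat (map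
     (\<lambda>e. map (\<lambda>x. x \<otimes>\<^bsub>split_ring n f\<^esub> (split_root n f (Suc k) [^]\<^bsub>split_ring n f\<^esub> e)) (basis_seq n f k))
     [0..<n - k])"

definition R_basis :: "nat \<Rightarrow> 'a::ring_1 poly \<Rightarrow> ((nat \<Rightarrow>\<^sub>0 nat) \<Rightarrow>\<^sub>0 'a) set list" where
  "R_basis n f = basis_seq n f (n - 1)"

definition A_mat :: "nat \<Rightarrow> 'a::ring_1 poly \<Rightarrow> nat \<Rightarrow> 'a mat" where
  "A_mat n f i = left_mult_mat (split_ring n f) UNIV (emb n f) (R_basis n f) (split_root n f i)"

text \<open>\<open>S = R[r\<^sub>1]\<close> and the \<open>S\<close>-basis \<open>r\<^sub>2^\<alpha>\<^sub>2 \<cdots> r\<^sub>n^\<alpha>\<^sub>n\<close>, in the order of occurrence in \<open>s\<^sub>n\<^sub>-\<^sub>1\<close>.\<close>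

definition S_ring :: "nat \<Rightarrow> 'a::ring_1 poly \<Rightarrow> ((nat \<Rightarrow>\<^sub>0 nat) \<Rightarrow>\<^sub>0 'a) set set" where
  "S_ring n f = generate_ring (split_ring n f) (insert (split_root n f 1) (range (emb n f)))"

definition S_basis_set :: "nat \<Rightarrow> 'a::ring_1 poly \<Rightarrow> ((nat \<Rightarrow>\<^sub>0 nat) \<Rightarrow>\<^sub>0 'a) set set" where
  "S_basis_set n f =
     {foldr (\<lambda>i y. (split_root n f i [^]\<^bsub>split_ring n f\<^esub> \<alpha> i) \<otimes>\<^bsub>split_ring n f\<^esub> y)
        [2..<Suc n] \<one>\<^bsub>split_ring n f\<^esub> | \<alpha> :: nat \<Rightarrow> nat. \<forall>i\<in>{2..n}. \<alpha> i \<le> n - i}"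

definition S_basis :: "nat \<Rightarrow> 'a::ring_1 poly \<Rightarrow> ((nat \<Rightarrow>\<^sub>0 nat) \<Rightarrow>\<^sub>0 'a) set list" where
  "S_basis n f = filter (\<lambda>x. x \<in> S_basis_set n f) (R_basis n f)"

definition B_mat ::
  "nat \<Rightarrow> 'a::ring_1 poly \<Rightarrow> nat \<Rightarrow> ((nat \<Rightarrow>\<^sub>0 nat) \<Rightarrow>\<^sub>0 'a) set mat" where
  "B_mat n f i = left_mult_mat (split_ring n f) (S_ring n f) (\<lambda>s. s) (S_basis n f) (split_root n f i)"


section \<open>Companion matrix and polynomial evaluation\<close>

definition companion :: "nat \<Rightarrow> 'a::ring_1 poly \<Rightarrow> 'a mat" where
  "companion n f = mat n n (\<lambda>(r, c).
     if c = n - 1 then - Polynomial.coeff f r else if r = Suc c then 1 else 0)"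

text \<open>\<open>poly_shift 1 p\<close> is \<open>(p - p(0)) / Z\<close>; \<open>bracket p j\<close> is \<open>p\<^sup>[\<^sup>j\<^sup>]\<close>.\<close>

primrec bracket :: "'a::zero poly \<Rightarrow> nat \<Rightarrow> 'a poly" where
  "bracket p 0 = poly_shift 1 p"
| "bracket p (Suc j) = poly_shift 1 (bracket p j)"

text \<open>
  The evaluation function \<open>poly\<close> needs a commutative coefficient ring.
\<close>

definition eval_mat :: "'a::ring_1 poly \<Rightarrow> 'a mat \<Rightarrow> 'a mat" where
  "eval_mat p C = mat (dim_row C) (dim_row C) (\<lambda>(r, c).
     \<Sum>k\<le>Polynomial.degree p. Polynomial.coeff p k * (C ^\<^sub>m k) $$ (r, c))"

definition eval_split ::
  "nat \<Rightarrow> 'a::ring_1 poly \<Rightarrow> 'a poly \<Rightarrow> ((nat \<Rightarrow>\<^sub>0 nat) \<Rightarrow>\<^sub>0 'a) set \<Rightarrow> ((nat \<Rightarrow>\<^sub>0 nat) \<Rightarrow>\<^sub>0 'a) set" where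
  "eval_split n f p x = (\<Oplus>\<^bsub>split_ring n f\<^esub>k\<in>{..Polynomial.degree p}.
     emb n f (Polynomial.coeff p k) \<otimes>\<^bsub>split_ring n f\<^esub> (x [^]\<^bsub>split_ring n f\<^esub> k))"

definition mat_block :: "nat \<Rightarrow> 'a mat \<Rightarrow> nat \<Rightarrow> nat \<Rightarrow> 'a mat" where
  "mat_block n A p q = mat n n (\<lambda>(r, c). A $$ (p * n + r, q * n + c))"

end

theory Submission
  imports Defs
begin

text \<open>
  Let \<open>g\<^sub>0 = f\<close> and \<open>g\<^sub>k\<^sub>+\<^sub>1(Z) = (g\<^sub>k(Z) - g\<^sub>k(X\<^sub>k\<^sub>+\<^sub>1)) / (Z - X\<^sub>k\<^sub>+\<^sub>1)\<close>.  Modulo the ideal of the splitting ring the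
  product of the \<open>Z - X\<^sub>i\<close> with \<open>i > k\<close> is \<open>g\<^sub>k\<close>, so this ideal is generated by the triangular family
  \<open>g\<^sub>k(X\<^sub>k\<^sub>+\<^sub>1)\<close>, which is monic in \<open>X\<^sub>k\<^sub>+\<^sub>1\<close> with central coefficients.  Successive division with remainder,
  starting from the last variable, kills the ideal and fixes the basis monomials; hence the basis is
  free.

  All rings \<open>R[r\<^sub>1, \<dots>, r\<^sub>k]\<close> live inside one ring, so the recursion over them is a downward induction on
  \<open>k\<close>.  The entries over \<open>R[r\<^sub>1, \<dots>, r\<^sub>k\<^sub>+\<^sub>1]\<close> are, up to sign, coefficients of \<open>g\<^sub>k\<^sub>+\<^sub>1\<close>, that is,
  \<open>g\<^sub>k\<^sup>[\<^sup>j\<^sup>](r\<^sub>k\<^sub>+\<^sub>1)\<close>, and these act on the powers of \<open>r\<^sub>k\<^sub>+\<^sub>1\<close> by \<open>g\<^sub>k\<^sup>[\<^sup>j\<^sup>]\<close> of the companion matrix of \<open>g\<^sub>k\<close>,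
  whose entries are again coefficients of \<open>g\<^sub>k\<close> up to sign.
\<close>

section \<open>Polynomials with non-commuting coefficients\<close>

type_synonym 'a mpol = "(nat \<Rightarrow>\<^sub>0 nat) \<Rightarrow>\<^sub>0 'a"

abbreviation mon :: "(nat \<Rightarrow>\<^sub>0 nat) \<Rightarrow> 'a::ring_1 mpol" where
  "mon m \<equiv> Poly_Mapping.single m 1"

section \<open>Central elements\<close>

definition central :: "'b::ring_1 \<Rightarrow> bool" where
  "central c \<longleftrightarrow> (\<forall>x. c * x = x * c)"

lemma centralD: "central c \<Longrightarrow> c * x = x * c"
  by (simp add: central_def)

lemma central_left_commute: "central c \<Longrightarrow> x * (c * y) = c * (x * y)"
  using centralD[of c x] by (simp flip: mult.assoc)

lemma central_closed [intro, simp]: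
  "central (0 :: 'b::ring_1)" "central (1 :: 'b)"
  "central (a :: 'b) \<Longrightarrow> central b \<Longrightarrow> central (a + b)"
  "central (a :: 'b) \<Longrightarrow> central b \<Longrightarrow> central (a - b)"
  "central (a :: 'b) \<Longrightarrow> central b \<Longrightarrow> central (a * b)"
  "central (a :: 'b) \<Longrightarrow> central (- a)"
proof -
  show "central (a * b)" if "central a" "central b" for a b :: 'b
    unfolding central_def
  proof
    fix x
    have "a * b * x = a * (x * b)"
      using that(2) by (simp add: central_def mult.assoc)
    also have "\<dots> = x * (a * b)"
      using that(1) by (simp add: central_left_commute)
    finally show "a * b * x = x * (a * b)" .
  qed
qed (auto simp: central_def algebra_simps)

lemma central_power [intro, simp]: "central a \<Longrightarrow> central (a ^ k)"
  by (induction k) auto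

lemma central_sum [intro, simp]: "(\<And>i. i \<in> A \<Longrightarrow> central (g i)) \<Longrightarrow> central (sum g A)"
  by (induction A rule: infinite_finite_induct) auto

section \<open>Sums of monomials and linear extension\<close>

lemma poly_mapping_eq_sum_single:
  "p = (\<Sum>m\<in>Poly_Mapping.keys p. Poly_Mapping.single m (Poly_Mapping.lookup p m))"
proof (rule poly_mapping_eqI)
  fix k
  have "Poly_Mapping.lookup (\<Sum>m\<in>Poly_Mapping.keys p. Poly_Mapping.single m (Poly_Mapping.lookup p m)) k
      = (\<Sum>m\<in>Poly_Mapping.keys p. if m = k then Poly_Mapping.lookup p m else 0)"
    by (simp add: lookup_sum lookup_single when_def)
  then show "Poly_Mapping.lookup p k = Poly_Mapping.lookup
      (\<Sum>m\<in>Poly_Mapping.keys p. Poly_Mapping.single m (Poly_Mapping.lookup p m)) k"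
    by (simp add: in_keys_iff)
qed

lemma poly_mapping_induct [case_names add single]:
  fixes p :: "'b \<Rightarrow>\<^sub>0 'c::comm_monoid_add"
  assumes "\<And>p q. P p \<Longrightarrow> P q \<Longrightarrow> P (p + q)" and "\<And>m a. P (Poly_Mapping.single m a)"
  shows "P p"
proof -
  have *: "finite A \<Longrightarrow> P (\<Sum>m\<in>A. Poly_Mapping.single m (g m))" for A g
    by (induction A rule: finite_induct) (use assms assms(2)[of undefined 0] in auto)
  show ?thesis
    by (subst poly_mapping_eq_sum_single) (rule *, simp)
qed

lemma poly_mapping_induct_keys [consumes 1, case_names zero add single]:
  fixes p :: "'b \<Rightarrow>\<^sub>0 'c::comm_monoid_add"
  assumes "\<And>m. m \<in> Poly_Mapping.keys p \<Longrightarrow> Q m"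
    and "P 0" "\<And>p q. P p \<Longrightarrow> P q \<Longrightarrow> P (p + q)" and "\<And>m a. Q m \<Longrightarrow> P (Poly_Mapping.single m a)"
  shows "P p"
proof -
  have *: "finite A \<Longrightarrow> (\<And>m. m \<in> A \<Longrightarrow> Q m) \<Longrightarrow> P (\<Sum>m\<in>A. Poly_Mapping.single m (g m))" for A g
    by (induction A rule: finite_induct) (use assms(2-) in auto)
  show ?thesis
    by (subst poly_mapping_eq_sum_single) (rule *, use assms(1) in auto)
qed

lemma single_eq_const_mon: "Poly_Mapping.single m a = mconst a * (mon m :: 'a::ring_1 mpol)"
  by (simp add: mconst_def mult_single)

lemma mconst_simps:
  "mconst (0::'a::ring_1) = 0" "mconst (1::'a) = 1"
  "mconst (a + b :: 'a) = mconst a + mconst b"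
  "mconst (a * b :: 'a) = mconst a * mconst b"
  "mconst (a - b :: 'a) = mconst a - mconst b"
  "mconst (- a :: 'a) = - mconst a"
  by (simp_all add: mconst_def single_add mult_single single_diff single_uminus)

lemma mconst_sum: "mconst (sum g A :: 'a::ring_1) = (\<Sum>i\<in>A. mconst (g i))"
  by (induction A rule: infinite_finite_induct) (auto simp: mconst_simps)

lemma central_mon [simp]: "central (mon m :: 'a::ring_1 mpol)"
  unfolding central_def
proof
  fix p :: "'a mpol"
  show "mon m * p = p * mon m"
    by (induction p rule: poly_mapping_induct) (simp_all add: algebra_simps mult_single)
qed

lemma central_mvar [simp]: "central (mvar i :: 'a::ring_1 mpol)"
  by (simp add: mvar_def)

lemma central_mconst:
  assumes "central (b::'a::ring_1)"
  shows "central (mconst b :: 'a mpol)"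
  unfolding central_def
proof
  fix p :: "'a mpol"
  show "mconst b * p = p * mconst b"
    by (induction p rule: poly_mapping_induct)
      (use assms in \<open>simp_all add: algebra_simps mult_single mconst_def central_def\<close>)
qed

lemma mon_add: "mon (m + m') = (mon m * mon m' :: 'a::ring_1 mpol)"
  by (simp add: mult_single)

lemma mvar_power: "(mvar i :: 'a::ring_1 mpol) ^ e = mon (Poly_Mapping.single i e)"
  by (induction e) (simp_all add: mvar_def mult_single flip: single_add)

text \<open>Coefficients stay on the left of \<open>\<phi> m\<close>, so the extension is left
  linear over the constants even where \<open>\<phi> m\<close> does not commute with them.\<close>

definition lin_ext :: "((nat \<Rightarrow>\<^sub>0 nat) \<Rightarrow> 'a::ring_1 mpol) \<Rightarrow> 'a mpol \<Rightarrow> 'a mpol" where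
  "lin_ext \<phi> p = (\<Sum>m\<in>Poly_Mapping.keys p. mconst (Poly_Mapping.lookup p m) * \<phi> m)"

lemma lin_ext_superset:
  assumes "finite A" "Poly_Mapping.keys p \<subseteq> A"
  shows "lin_ext \<phi> p = (\<Sum>m\<in>A. mconst (Poly_Mapping.lookup p m) * \<phi> m)"
  unfolding lin_ext_def
  by (rule sum.mono_neutral_left) (use assms in \<open>auto simp: in_keys_iff mconst_simps\<close>)

lemma lin_ext_add: "lin_ext \<phi> (p + q) = lin_ext \<phi> p + lin_ext \<phi> q"
proof -
  let ?A = "Poly_Mapping.keys p \<union> Poly_Mapping.keys q"
  have "Poly_Mapping.keys (p + q) \<subseteq> ?A"
    by (rule keys_add)
  then show ?thesis
    by (simp add: lin_ext_superset[of ?A] lookup_add mconst_simps distrib_right sum.distrib)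
qed

lemma lin_ext_single [simp]: "lin_ext \<phi> (Poly_Mapping.single m a) = mconst a * \<phi> m"
  by (subst lin_ext_superset[of "{m}"]) auto

lemma lin_ext_0 [simp]: "lin_ext \<phi> 0 = 0"
  by (simp add: lin_ext_def)

lemma lin_ext_sum: "lin_ext \<phi> (sum g A) = (\<Sum>i\<in>A. lin_ext \<phi> (g i))"
  by (induction A rule: infinite_finite_induct) (auto simp: lin_ext_add)

text \<open>
  The splitting ring uses the polynomials in \<open>X\<^sub>1, \<dots>, X\<^sub>n\<close> only, whereas congruences are taken modulo
  ideals of the whole type; the retraction \<open>restr\<close> relates the two.
\<close>

definition restr :: "nat set \<Rightarrow> 'a::ring_1 mpol \<Rightarrow> 'a mpol" where
  "restr V = lin_ext (\<lambda>m. if Poly_Mapping.keys m \<subseteq> V then mon m else 0)"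

definition in_vars :: "nat set \<Rightarrow> 'a::ring_1 mpol \<Rightarrow> bool" where
  "in_vars V p \<longleftrightarrow> (\<forall>m\<in>Poly_Mapping.keys p. Poly_Mapping.keys m \<subseteq> V)"

lemma keys_add_nat: "Poly_Mapping.keys (m + m' :: nat \<Rightarrow>\<^sub>0 nat) = Poly_Mapping.keys m \<union> Poly_Mapping.keys m'"
  by (auto simp: in_keys_iff lookup_add)

lemma in_vars_single: "Poly_Mapping.keys m \<subseteq> V \<Longrightarrow> in_vars V (Poly_Mapping.single m a)"
  by (simp add: in_vars_def)

lemma in_vars_0 [intro, simp]: "in_vars V 0"
  by (simp add: in_vars_def)

lemma in_vars_add [intro, simp]: "in_vars V p \<Longrightarrow> in_vars V q \<Longrightarrow> in_vars V (p + q)"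
  unfolding in_vars_def using keys_add[of p q] by blast

lemma in_vars_mult [intro, simp]: "in_vars V p \<Longrightarrow> in_vars V q \<Longrightarrow> in_vars V (p * q)"
  unfolding in_vars_def using keys_mult[of p q] keys_add_nat by blast

lemma in_vars_const [intro, simp]: "in_vars V (mconst a)"
  by (simp add: mconst_def in_vars_single)

lemma in_vars_1 [intro, simp]: "in_vars V 1"
  by (metis in_vars_const mconst_simps(2))

lemma in_vars_uminus [intro, simp]: "in_vars V p \<Longrightarrow> in_vars V (- p)"
  by (simp add: in_vars_def in_keys_iff)

lemma in_vars_diff [intro, simp]: "in_vars V p \<Longrightarrow> in_vars V q \<Longrightarrow> in_vars V (p - q)"
  by (metis diff_conv_add_uminus in_vars_add in_vars_uminus)

lemma in_vars_sum [intro, simp]: "(\<And>i. i \<in> A \<Longrightarrow> in_vars V (g i)) \<Longrightarrow> in_vars V (sum g A)"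
  by (induction A rule: infinite_finite_induct) auto

lemma in_vars_power [intro, simp]: "in_vars V p \<Longrightarrow> in_vars V (p ^ e)"
  by (induction e) auto

lemma in_vars_mvar [intro]: "i \<in> V \<Longrightarrow> in_vars V (mvar i)"
  by (simp add: mvar_def in_vars_single)

lemma in_vars_mono: "in_vars V p \<Longrightarrow> V \<subseteq> W \<Longrightarrow> in_vars W p"
  by (auto simp: in_vars_def)

lemma restr_add: "restr V (p + q) = restr V p + restr V q"
  by (simp add: restr_def lin_ext_add)

lemma restr_single: "restr V (Poly_Mapping.single m a) = (if Poly_Mapping.keys m \<subseteq> V then Poly_Mapping.single m a else 0)"
  by (simp add: restr_def flip: single_eq_const_mon)

text \<open>Setting the variables outside \<open>V\<close> to 0 is a ring homomorphism: exponents
  cannot cancel, so a product of two monomials avoids these variables iff both factors do.\<close>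

lemma restr_mult: "restr V (p * q) = restr V p * restr V q"
proof (induction p rule: poly_mapping_induct)
  case (add p p')
  then show ?case by (simp add: restr_add distrib_right)
next
  case (single m a)
  show ?case
    by (induction q rule: poly_mapping_induct)
      (simp_all add: restr_add distrib_left restr_single mult_single keys_add_nat)
qed

lemma restr_0: "restr V 0 = 0"
  by (simp add: restr_def)

lemma in_vars_restr: "in_vars V (restr V p)"
  by (induction p rule: poly_mapping_induct) (auto simp: restr_add restr_single in_vars_single)

lemma restr_ident:
  assumes "in_vars V p"
  shows "restr V p = p"
proof -
  have "m \<in> Poly_Mapping.keys p \<Longrightarrow> Poly_Mapping.keys m \<subseteq> V" for m
    using assms by (simp add: in_vars_def)
  then show ?thesis
    by (induction p rule: poly_mapping_induct_keys) (auto simp: restr_0 restr_add restr_single)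
qed

section \<open>Two-sided ideals and congruence\<close>

definition two_sided :: "'b::ring_1 set \<Rightarrow> bool" where
  "two_sided K \<longleftrightarrow> 0 \<in> K \<and> (\<forall>x\<in>K. \<forall>y\<in>K. x + y \<in> K) \<and> (\<forall>x\<in>K. \<forall>y. x * y \<in> K \<and> y * x \<in> K)"

lemma two_sidedD:
  assumes "two_sided K"
  shows "0 \<in> K" "x \<in> K \<Longrightarrow> y \<in> K \<Longrightarrow> x + y \<in> K" "x \<in> K \<Longrightarrow> x * z \<in> K" "x \<in> K \<Longrightarrow> z * x \<in> K"
    "x \<in> K \<Longrightarrow> - x \<in> K" "x \<in> K \<Longrightarrow> y \<in> K \<Longrightarrow> x - y \<in> K"
proof -
  show "0 \<in> K"
    using assms by (simp add: two_sided_def)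
  show add: "x \<in> K \<Longrightarrow> y \<in> K \<Longrightarrow> x + y \<in> K" for x y
    using assms by (simp add: two_sided_def)
  show m: "x \<in> K \<Longrightarrow> z * x \<in> K" for x z
    using assms by (simp add: two_sided_def)
  show "x \<in> K \<Longrightarrow> x * z \<in> K" for x z
    using assms by (simp add: two_sided_def)
  show neg: "x \<in> K \<Longrightarrow> - x \<in> K" for x
    using m[of x "-1"] by simp
  show "x \<in> K \<Longrightarrow> y \<in> K \<Longrightarrow> x - y \<in> K"
    using add[of x "- y"] neg by simp
qed

definition cong_ideal :: "'b::ring_1 set \<Rightarrow> 'b \<Rightarrow> 'b \<Rightarrow> bool" where
  "cong_ideal K x y \<longleftrightarrow> x - y \<in> K"

lemma cong_ideal_rules:
  assumes "two_sided K"
  shows cong_ideal_refl: "cong_ideal K x x"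
    and cong_ideal_sym: "cong_ideal K x y \<Longrightarrow> cong_ideal K y x"
    and cong_ideal_trans: "cong_ideal K x y \<Longrightarrow> cong_ideal K y z \<Longrightarrow> cong_ideal K x z"
    and cong_ideal_add: "cong_ideal K x y \<Longrightarrow> cong_ideal K x' y' \<Longrightarrow> cong_ideal K (x + x') (y + y')"
    and cong_ideal_diff: "cong_ideal K x y \<Longrightarrow> cong_ideal K x' y' \<Longrightarrow> cong_ideal K (x - x') (y - y')"
    and cong_ideal_uminus: "cong_ideal K x y \<Longrightarrow> cong_ideal K (- x) (- y)"
    and cong_ideal_multL: "cong_ideal K x y \<Longrightarrow> cong_ideal K (z * x) (z * y)"
    and cong_ideal_multR: "cong_ideal K x y \<Longrightarrow> cong_ideal K (x * z) (y * z)"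
proof -
  note D = two_sidedD[OF assms]
  show "cong_ideal K x x" by (simp add: cong_ideal_def D)
  show "cong_ideal K x y \<Longrightarrow> cong_ideal K y x"
    unfolding cong_ideal_def using D(5)[of "x - y"] by simp
  show "cong_ideal K x y \<Longrightarrow> cong_ideal K y z \<Longrightarrow> cong_ideal K x z"
    unfolding cong_ideal_def using D(2)[of "x - y" "y - z"] by simp
  show "cong_ideal K x y \<Longrightarrow> cong_ideal K x' y' \<Longrightarrow> cong_ideal K (x + x') (y + y')"
    unfolding cong_ideal_def using D(2)[of "x - y" "x' - y'"] by (simp add: algebra_simps)
  show "cong_ideal K x y \<Longrightarrow> cong_ideal K x' y' \<Longrightarrow> cong_ideal K (x - x') (y - y')"
    unfolding cong_ideal_def using D(6)[of "x - y" "x' - y'"] by (simp add: algebra_simps)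
  show "cong_ideal K x y \<Longrightarrow> cong_ideal K (- x) (- y)"
    unfolding cong_ideal_def using D(5)[of "x - y"] by (simp add: algebra_simps)
  show "cong_ideal K x y \<Longrightarrow> cong_ideal K (z * x) (z * y)"
    unfolding cong_ideal_def using D(4)[of "x - y" z] by (simp add: algebra_simps)
  show "cong_ideal K x y \<Longrightarrow> cong_ideal K (x * z) (y * z)"
    unfolding cong_ideal_def using D(3)[of "x - y" z] by (simp add: algebra_simps)
qed

lemma cong_ideal_sum:
  assumes "two_sided K" "\<And>i. i \<in> A \<Longrightarrow> cong_ideal K (g i) (h i)"
  shows "cong_ideal K (sum g A) (sum h A)"
  using assms(2)
  by (induction A rule: infinite_finite_induct)
    (auto intro: cong_ideal_refl[OF assms(1)] cong_ideal_add[OF assms(1)])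


section \<open>Iterated quotients and reduction\<close>

locale central_monic =
  fixes n :: nat and f :: "'a::ring_1 poly"
  assumes n_pos: "n \<ge> 1" and deg_f: "Polynomial.degree f = n" and lead_f: "Polynomial.coeff f n = 1"
    and central_coeff_lt: "k < n \<Longrightarrow> central (Polynomial.coeff f k)"
begin

lemma central_coeff [simp]: "central (Polynomial.coeff f k)"
proof (cases "k < n")
  case False
  then show ?thesis
    using lead_f deg_f by (cases "k = n") (auto simp: Polynomial.coeff_eq_0)
qed (rule central_coeff_lt)

text \<open>
  \<open>G k j\<close> is the coefficient of \<open>Z\<^sup>j\<close> in the \<open>k\<close>-th iterated quotient \<open>g\<^sub>k\<close>, where \<open>g\<^sub>0 = f\<close> and
  \<open>g\<^sub>k\<^sub>+\<^sub>1(Z) = (g\<^sub>k(Z) - g\<^sub>k(X\<^sub>k\<^sub>+\<^sub>1)) / (Z - X\<^sub>k\<^sub>+\<^sub>1)\<close>, before passing to the splitting ring; \<open>\<gamma> k\<close> is \<open>g\<^sub>k(X\<^sub>k\<^sub>+\<^sub>1)\<close>.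
\<close>

primrec G :: "nat \<Rightarrow> nat \<Rightarrow> 'a mpol" where
  "G 0 j = mconst (Polynomial.coeff f j)"
| "G (Suc k) j = (\<Sum>t<n. G k (j + 1 + t) * mvar (Suc k) ^ t)"

declare G.simps(2) [simp del]

definition \<gamma> :: "nat \<Rightarrow> 'a mpol" where
  "\<gamma> k = G k 0 + mvar (Suc k) * G (Suc k) 0"

lemma central_G [simp]: "central (G k j)"
  by (induction k arbitrary: j) (auto simp: central_mconst G.simps(2))

lemma central_\<gamma> [simp]: "central (\<gamma> k)"
  by (simp add: \<gamma>_def)

lemma in_vars_G: "in_vars {1..k} (G k j)"
proof (induction k arbitrary: j)
  case (Suc k)
  have "in_vars {1..Suc k} (G k j)" for j
    using Suc by (rule in_vars_mono) auto
  then show ?case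
    by (auto simp: G.simps(2) intro!: in_vars_sum in_vars_mult in_vars_power in_vars_mvar)
qed auto

lemma in_vars_\<gamma>: "in_vars {1..Suc k} (\<gamma> k)"
  unfolding \<gamma>_def
  using in_vars_mono[OF in_vars_G[of k 0], of "{1..Suc k}"] in_vars_G[of "Suc k"]
  by (auto intro!: in_vars_add in_vars_mult in_vars_mvar)

text \<open>Each division by a linear factor lowers the degree by one, so \<open>g\<^sub>k\<close>
  has degree at most \<open>n - k\<close>. Hence the uniform bound \<open>t < n\<close> in the
  recursion of \<open>G\<close> cuts off no non-zero term.\<close>

lemma G_eq_0: "j > n - k \<Longrightarrow> G k j = 0"
proof (induction k arbitrary: j)
  case 0
  then show ?case using deg_f by (simp add: Polynomial.coeff_eq_0 mconst_simps)
next
  case (Suc k)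
  show ?case
    unfolding G.simps(2) by (rule sum.neutral) (use Suc in auto)
qed

lemma G_lead: "k \<le> n \<Longrightarrow> G k (n - k) = 1"
proof (induction k)
  case 0
  then show ?case using lead_f by (simp add: mconst_simps)
next
  case (Suc k)
  have "G (Suc k) (n - Suc k) = (\<Sum>t<n. if t = 0 then 1 else 0)"
    unfolding G.simps(2)
  proof (rule sum.cong)
    fix t assume "t \<in> {..<n}"
    have *: "n - Suc k + 1 + t = n - k + t" using Suc.prems by simp
    show "G k (n - Suc k + 1 + t) * mvar (Suc k) ^ t = (if t = 0 then 1 else 0)"
      unfolding * using Suc by (auto simp: G_eq_0)
  qed simp
  then show ?case using n_pos by simp
qed

text \<open>Synthetic division: with \<open>X = mvar (Suc k)\<close>, compare the coefficients of
  \<open>Z^(j+1)\<close> in \<open>(Z - X) g\<^sub>k\<^sub>+\<^sub>1(Z) = g\<^sub>k(Z) -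
  g\<^sub>k(X)\<close>.\<close>

lemma G_step: "G (Suc k) j = G k (Suc j) + mvar (Suc k) * G (Suc k) (Suc j)"
proof -
  \<comment> \<open>The added term \<open>t = n\<close> vanishes for degree reasons; with it the
    remaining sum after the index shift again runs over \<open>t < n\<close>.\<close>
  have "G (Suc k) j = (\<Sum>t<Suc n. G k (j + 1 + t) * mvar (Suc k) ^ t)"
    by (simp add: G.simps(2) G_eq_0)
  also have "\<dots> = G k (Suc j) + (\<Sum>t<n. G k (Suc j + 1 + t) * (mvar (Suc k) * mvar (Suc k) ^ t))"
    by (subst sum.lessThan_Suc_shift) simp
  also have "(\<Sum>t<n. G k (Suc j + 1 + t) * (mvar (Suc k) * mvar (Suc k) ^ t)) = mvar (Suc k) * G (Suc k) (Suc j)"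
    by (simp only: G.simps(2) sum_distrib_left central_left_commute[OF central_mvar])
  finally show ?thesis .
qed

text \<open>Expanding the Horner form of \<open>\<gamma> k\<close> shows it to be monic of degree
  \<open>n - k\<close> in \<open>mvar (Suc k)\<close>, which is the relation that drives the
  division.\<close>

lemma \<gamma>_eq_sum:
  assumes "k < n"
  shows "\<gamma> k = (\<Sum>j<n - k. mvar (Suc k) ^ j * G k j) + mvar (Suc k) ^ (n - k)"
proof -
  have "\<gamma> k = G k 0 + (\<Sum>t<n. G k (Suc t) * mvar (Suc k) ^ Suc t)"
    unfolding \<gamma>_def G.simps(2) sum_distrib_left
    by (simp add: central_left_commute[OF central_mvar])
  also have "\<dots> = (\<Sum>t<Suc n. G k t * mvar (Suc k) ^ t)"
    by (subst sum.lessThan_Suc_shift) simp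
  also have "\<dots> = (\<Sum>t<Suc (n - k). G k t * mvar (Suc k) ^ t)"
    by (rule sum.mono_neutral_right) (auto simp: G_eq_0)
  finally show ?thesis
    using assms by (simp add: G_lead centralD[OF central_G])
qed

lemma G_n: "G n j = (if j = 0 then 1 else 0)"
  using G_lead[of n] G_eq_0[of n j] by auto

text \<open>
  \<open>rho k e\<close> is the remainder of \<open>X\<^sub>k\<^sub>+\<^sub>1\<^sup>e\<close> on division by \<open>g\<^sub>k\<close> in the variable \<open>X\<^sub>k\<^sub>+\<^sub>1\<close>, and \<open>red k\<close>
  extends this to all polynomials, linearly over the other variables.
\<close>

function rho :: "nat \<Rightarrow> nat \<Rightarrow> 'a mpol" where
  "rho k e = (if e < n - k \<or> n \<le> k then mvar (Suc k) ^ e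
     else - (\<Sum>j<n - k. G k j * rho k (e - (n - k) + j)))"
  by auto
text \<open>The recursive argument is smaller than \<open>e\<close> because
  \<open>j < n - k \<le> e\<close>.\<close>

termination by (relation "measure snd") auto

declare rho.simps [simp del]

definition red :: "nat \<Rightarrow> 'a mpol \<Rightarrow> 'a mpol" where
  "red k = lin_ext (\<lambda>m. mon (m - Poly_Mapping.single (Suc k) (Poly_Mapping.lookup m (Suc k)))
     * rho k (Poly_Mapping.lookup m (Suc k)))"

lemma red_add: "red k (p + q) = red k p + red k q"
  by (simp add: red_def lin_ext_add)

lemma red_sum: "red k (sum g A) = (\<Sum>i\<in>A. red k (g i))"
  by (simp add: red_def lin_ext_sum)

lemma red_0 [simp]: "red k 0 = 0"
  by (simp add: red_def)

text \<open>Polynomials free of the variable of division act as scalars, since multiplying by them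
  changes no exponent of that variable. The factor stands on the left because it need not be
  central.\<close>

lemma red_mult_left:
  assumes "in_vars V q" "Suc k \<notin> V"
  shows "red k (q * p) = q * red k p"
proof -
  have *: "red k (Poly_Mapping.single m a * p) = Poly_Mapping.single m a * red k p"
    if m: "Suc k \<notin> Poly_Mapping.keys m" for m a
  proof (induction p rule: poly_mapping_induct)
    case (add p q)
    then show ?case by (simp add: distrib_left red_add)
  next
    case (single m' b)
    have l: "Poly_Mapping.lookup (m + m') (Suc k) = Poly_Mapping.lookup m' (Suc k)"
      using m by (simp add: lookup_add in_keys_iff)
    have s: "m + m' - Poly_Mapping.single (Suc k) (Poly_Mapping.lookup m' (Suc k))
        = m + (m' - Poly_Mapping.single (Suc k) (Poly_Mapping.lookup m' (Suc k)))"
      by (rule poly_mapping_eqI)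
        (use m in \<open>auto simp: lookup_add lookup_minus lookup_single when_def in_keys_iff\<close>)
    show ?case
      unfolding red_def mult_single lin_ext_single l s
      by (subst single_eq_const_mon[of m a]) (simp add: mconst_simps mon_add mult.assoc
          central_left_commute[OF central_mon[of m], of "mconst b"])
  qed
  from assms have "m \<in> Poly_Mapping.keys q \<Longrightarrow> Suc k \<notin> Poly_Mapping.keys m" for m
    by (auto simp: in_vars_def)
  then show ?thesis
    by (induction q rule: poly_mapping_induct_keys) (auto simp: red_add distrib_right *)
qed

lemma red_power: "red k (mvar (Suc k) ^ e) = rho k e"
  by (simp add: red_def mvar_power mconst_simps)

text \<open>The recursion of \<open>rho\<close> at the exponent \<open>e + (n - k)\<close> is
  exactly the relation \<open>X^e g\<^sub>k(X) = 0\<close> solved for its top power.\<close>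

lemma red_power_\<gamma>:
  assumes "k < n"
  shows "red k (mvar (Suc k) ^ e * \<gamma> k) = 0"
proof -
  have v: "in_vars {1..k} (G k j)" "Suc k \<notin> {1..k}" for j
    by (rule in_vars_G) simp
  have "mvar (Suc k) ^ e * \<gamma> k = (\<Sum>j<n - k. G k j * mvar (Suc k) ^ (e + j)) + mvar (Suc k) ^ (e + (n - k))"
    by (simp add: \<gamma>_eq_sum[OF assms] distrib_left sum_distrib_left power_add
        centralD[OF central_G] mult.assoc)
  then have "red k (mvar (Suc k) ^ e * \<gamma> k) = (\<Sum>j<n - k. G k j * rho k (e + j)) + rho k (e + (n - k))"
    by (simp only: red_add red_sum red_mult_left[OF v] red_power)
  also have "rho k (e + (n - k)) = - (\<Sum>j<n - k. G k j * rho k (e + j))"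
    by (subst rho.simps) (use assms in auto)
  finally show ?thesis by simp
qed

text \<open>In each monomial the power of \<open>mvar (Suc k)\<close> is split off; what is left is
  a scalar for the division.\<close>

lemma red_mult_\<gamma>:
  assumes "k < n"
  shows "red k (p * \<gamma> k) = 0"
proof (induction p rule: poly_mapping_induct)
  case (single m a)
  let ?e = "Poly_Mapping.lookup m (Suc k)"
  let ?m = "m - Poly_Mapping.single (Suc k) ?e"
  have m: "m = ?m + Poly_Mapping.single (Suc k) ?e"
    by (rule poly_mapping_eqI) (auto simp: lookup_add lookup_minus lookup_single when_def)
  have "Poly_Mapping.single m a = Poly_Mapping.single ?m a * mvar (Suc k) ^ ?e"
    by (subst m) (simp add: mvar_power mult_single)
  then have "red k (Poly_Mapping.single m a * \<gamma> k)
      = red k (Poly_Mapping.single ?m a * (mvar (Suc k) ^ ?e * \<gamma> k))"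
    by (simp add: mult.assoc)
  also have "\<dots> = Poly_Mapping.single ?m a * red k (mvar (Suc k) ^ ?e * \<gamma> k)"
    by (rule red_mult_left[of "Poly_Mapping.keys ?m"])
      (auto simp: in_vars_single in_keys_iff lookup_minus)
  finally show ?case by (simp add: red_power_\<gamma>[OF assms])
qed (simp add: distrib_right red_add)

lemma red_single_ident:
  assumes "Poly_Mapping.lookup m (Suc k) < n - k"
  shows "red k (Poly_Mapping.single m a) = Poly_Mapping.single m a"
proof -
  let ?e = "Poly_Mapping.lookup m (Suc k)"
  have m: "m - Poly_Mapping.single (Suc k) ?e + Poly_Mapping.single (Suc k) ?e = m"
    by (rule poly_mapping_eqI) (auto simp: lookup_add lookup_minus lookup_single when_def)
  have "rho k ?e = mvar (Suc k) ^ ?e"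
    using assms by (simp add: rho.simps)
  then have "red k (Poly_Mapping.single m a)
      = mconst a * (mon (m - Poly_Mapping.single (Suc k) ?e) * mon (Poly_Mapping.single (Suc k) ?e))"
    by (simp add: red_def mvar_power)
  also have "\<dots> = Poly_Mapping.single m a"
    by (simp only: flip: mon_add) (simp only: m flip: single_eq_const_mon)
  finally show ?thesis .
qed

section \<open>Normal forms and independence modulo the triangular family\<close>

primrec normal :: "nat \<Rightarrow> 'a mpol \<Rightarrow> 'a mpol" where
  "normal 0 p = p"
| "normal (Suc m) p = normal m (red m p)"

lemma normal_0 [simp]: "normal m 0 = 0"
  by (induction m) auto

lemma normal_add: "normal m (p + q) = normal m p + normal m q"
  by (induction m arbitrary: p q) (auto simp: red_add)

lemma normal_sum: "normal m (sum g A) = (\<Sum>i\<in>A. normal m (g i))"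
  by (induction A rule: infinite_finite_induct) (auto simp: normal_add)

text \<open>\<open>\<gamma> k\<close> involves only the first \<open>k + 1\<close> variables, so the
  divisions in later variables, which come first, treat it as a scalar. The division in
  \<open>mvar (Suc k)\<close> then kills the product.\<close>

lemma normal_mult_\<gamma>: "m \<le> n \<Longrightarrow> k < m \<Longrightarrow> normal m (p * \<gamma> k) = 0"
proof (induction m arbitrary: p)
  case (Suc m)
  show ?case
  proof (cases "k = m")
    case True
    then show ?thesis using Suc.prems red_mult_\<gamma>[of m p] by simp
  next
    case False
    have "red m (p * \<gamma> k) = red m p * \<gamma> k"
      using red_mult_left[OF in_vars_\<gamma>[of k], of m p] False Suc.prems
      by (simp add: centralD[OF central_\<gamma>])
    then show ?thesis using Suc False by simp
  qed
qed simp

lemma normal_single_ident: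
  "(\<And>k. k < m \<Longrightarrow> Poly_Mapping.lookup \<alpha> (Suc k) < n - k) \<Longrightarrow>
    normal m (Poly_Mapping.single \<alpha> a) = Poly_Mapping.single \<alpha> a"
  by (induction m) (auto simp: red_single_ident)

text \<open>The ideal generated by the triangular family among the polynomials in all variables. As
  the \<open>\<gamma> k\<close> are central, left combinations already form a two-sided
  ideal.\<close>

definition J :: "'a mpol set" where
  "J = {p. \<exists>u. p = (\<Sum>k<n. u k * \<gamma> k)}"

lemma two_sided_J: "two_sided J"
  unfolding two_sided_def
proof (intro conjI ballI allI)
  show "0 \<in> J"
    unfolding J_def by (auto intro!: exI[of _ "\<lambda>_. 0"])
  fix x assume "x \<in> J"
  then obtain u where u: "x = (\<Sum>k<n. u k * \<gamma> k)" unfolding J_def by blast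
  show "y * x \<in> J" for y
    unfolding J_def u by (auto intro!: exI[of _ "\<lambda>k. y * u k"] simp: sum_distrib_left mult.assoc)
  show "x * y \<in> J" for y
    unfolding J_def u by (auto intro!: exI[of _ "\<lambda>k. u k * y"] simp: sum_distrib_right mult.assoc centralD[OF central_\<gamma>])
  fix y assume "y \<in> J"
  then obtain v where v: "y = (\<Sum>k<n. v k * \<gamma> k)" unfolding J_def by blast
  show "x + y \<in> J"
    unfolding J_def u v by (auto intro!: exI[of _ "\<lambda>k. u k + v k"] simp: sum.distrib distrib_right)
qed

lemma \<gamma>_in_J: "k < n \<Longrightarrow> \<gamma> k \<in> J"
  unfolding J_def by (auto intro!: exI[of _ "\<lambda>i. if i = k then 1 else 0"] simp: if_distrib[of "\<lambda>x. x * _"] cong: if_cong)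

lemma normal_J: "p \<in> J \<Longrightarrow> normal n p = 0"
  unfolding J_def by (auto simp: normal_sum normal_mult_\<gamma>)

text \<open>With \<open>i = k + 1\<close> this is the condition
  \<open>\<alpha>\<^sub>i \<le> n - i\<close> on the basis exponents; variables beyond the
  \<open>n\<close>-th are left free.\<close>

definition bounded :: "(nat \<Rightarrow>\<^sub>0 nat) \<Rightarrow> bool" where
  "bounded \<alpha> \<longleftrightarrow> (\<forall>k<n. Poly_Mapping.lookup \<alpha> (Suc k) < n - k)"

text \<open>\<open>normal n\<close> annihilates \<open>J\<close> and fixes bounded monomials, so the
  combination is zero as a polynomial, and distinct monomials force each coefficient to
  vanish.\<close>

lemma independent_mod_J:
  assumes "finite Q" "inj_on \<alpha> Q" "\<And>q. q \<in> Q \<Longrightarrow> bounded (\<alpha> q)"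
    and "(\<Sum>q\<in>Q. mon (\<alpha> q) * mconst (c q)) \<in> J" and "q \<in> Q"
  shows "c q = 0"
proof -
  have "(\<Sum>q\<in>Q. Poly_Mapping.single (\<alpha> q) (c q)) = normal n (\<Sum>q\<in>Q. Poly_Mapping.single (\<alpha> q) (c q))"
    unfolding normal_sum
    by (rule sum.cong) (use assms(3) in \<open>auto simp: normal_single_ident bounded_def\<close>)
  also have "(\<Sum>q\<in>Q. Poly_Mapping.single (\<alpha> q) (c q)) = (\<Sum>q\<in>Q. mon (\<alpha> q) * mconst (c q))"
    by (simp add: mconst_def mult_single)
  also have "normal n \<dots> = 0"
    using assms(4) by (rule normal_J)
  finally have "Poly_Mapping.lookup (\<Sum>q\<in>Q. Poly_Mapping.single (\<alpha> q) (c q)) (\<alpha> q) = 0"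
    by (simp add: mconst_def mult_single)
  moreover have "Poly_Mapping.lookup (\<Sum>q\<in>Q. Poly_Mapping.single (\<alpha> q) (c q)) (\<alpha> q)
      = (\<Sum>i\<in>Q. if i = q then c q else 0)"
    unfolding lookup_sum
    by (rule sum.cong) (use assms(2,5) in \<open>auto simp: lookup_single when_def dest: inj_onD\<close>)
  ultimately show ?thesis using assms(1,5) by simp
qed

end


section \<open>The ideal of the splitting ring\<close>

declare One_nat_def [simp del]

lemma two_sided_sum: "two_sided K \<Longrightarrow> (\<And>i. i \<in> A \<Longrightarrow> g i \<in> K) \<Longrightarrow> sum g A \<in> K"
  by (induction A rule: infinite_finite_induct) (auto simp: two_sidedD)

section \<open>Elementary symmetric polynomials in a set of variables\<close>

definition esum :: "nat set \<Rightarrow> nat \<Rightarrow> 'a::ring_1 mpol" where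
  "esum U k = (\<Sum>A | A \<subseteq> U \<and> card A = k. mon (\<Sum>i\<in>A. Poly_Mapping.single i 1))"

lemma elem_sym_eq_esum: "elem_sym n k = esum {1..n} k"
  by (simp add: elem_sym_def esum_def)

lemma esum_0: "finite U \<Longrightarrow> esum U 0 = 1"
proof -
  assume "finite U"
  then have "{A. A \<subseteq> U \<and> card A = 0} = {{}}"
    by (auto dest: finite_subset)
  then show ?thesis by (simp add: esum_def)
qed

text \<open>The subsets of size \<open>k + 1\<close> are sorted by whether they contain
  \<open>a\<close>.\<close>

lemma esum_insert:
  assumes "finite U" "a \<notin> U"
  shows "esum (insert a U) (Suc k) = esum U (Suc k) + mvar a * esum U k"
proof -
  let ?A = "{A. A \<subseteq> U \<and> card A = Suc k}" and ?B = "{A. A \<subseteq> U \<and> card A = k}"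
  have fin: "finite ?A" "finite ?B"
    using assms by (auto intro: finite_subset[of _ "Pow U"])
  have split: "{A. A \<subseteq> insert a U \<and> card A = Suc k} = ?A \<union> insert a ` ?B" (is "?L = ?R")
  proof
    show "?L \<subseteq> ?R"
    proof
      fix A assume A: "A \<in> ?L"
      then have "finite A" using assms(1) by (auto intro: finite_subset[of _ "insert a U"])
      show "A \<in> ?R"
      proof (cases "a \<in> A")
        case True
        then have "A = insert a (A - {a})" "card (A - {a}) = k"
          using A \<open>finite A\<close> by auto
        then show ?thesis using A by blast
      qed (use A in auto)
    qed
    show "?R \<subseteq> ?L"
      using assms by (auto simp: finite_subset card_insert_if)
  qed
  have disj: "?A \<inter> insert a ` ?B = {}"
    using assms(2) by auto
  have inj: "inj_on (insert a) ?B"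
    using assms(2) by (force simp: inj_on_def)
  have "(\<Sum>A\<in>insert a ` ?B. mon (\<Sum>i\<in>A. Poly_Mapping.single i 1) :: 'a mpol)
      = (\<Sum>A\<in>?B. mvar a * mon (\<Sum>i\<in>A. Poly_Mapping.single i 1))"
    unfolding sum.reindex[OF inj] o_def
  proof (rule sum.cong)
    fix A assume "A \<in> ?B"
    then have "finite A" "a \<notin> A"
      using assms by (auto intro: finite_subset)
    then show "(mon (\<Sum>i\<in>insert a A. Poly_Mapping.single i 1) :: 'a mpol)
        = mvar a * mon (\<Sum>i\<in>A. Poly_Mapping.single i 1)"
      by (simp add: mvar_def mult_single)
  qed simp
  then show ?thesis
    unfolding esum_def split sum_distrib_left
    by (subst sum.union_disjoint[OF fin(1) finite_imageI[OF fin(2)] disj]) simp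
qed

context central_monic
begin

text \<open>By Vieta, this is the coefficient of \<open>Z^j\<close> in the product of the factors
  \<open>Z - X\<^sub>i\<close> with \<open>k < i \<le> n\<close>.\<close>

definition E :: "nat \<Rightarrow> nat \<Rightarrow> 'a mpol" where
  "E k j = (if j \<le> n - k then (- 1) ^ (n - k - j) * esum {Suc k..n} (n - k - j) else 0)"

lemma esum_atLeastAtMost_insert:
  assumes "k < n"
  shows "esum {Suc k..n} (Suc s) = esum {Suc (Suc k)..n} (Suc s) + mvar (Suc k) * (esum {Suc (Suc k)..n} s :: 'a mpol)"
proof -
  have "{Suc k..n} = insert (Suc k) {Suc (Suc k)..n}"
    using assms by auto
  then show ?thesis using esum_insert[of "{Suc (Suc k)..n}" "Suc k"] by simp
qed

lemma esum_gt_card: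
  assumes "finite U" "card U < k"
  shows "esum U k = (0 :: 'a mpol)"
proof -
  have "{A. A \<subseteq> U \<and> card A = k} = {}"
    using card_mono[OF assms(1)] assms(2) by (auto simp: not_le[symmetric])
  then show ?thesis by (simp only: esum_def sum.empty)
qed

lemma central_minus_one_power: "central ((- 1) ^ s :: 'a mpol)"
  by simp

text \<open>Coefficient of \<open>Z^(j+1)\<close> after the factor with root
  \<open>mvar (Suc k)\<close> is split off the product.\<close>

lemma E_step:
  assumes "k < n"
  shows "E k (Suc j) = E (Suc k) j - mvar (Suc k) * E (Suc k) (Suc j)"
proof (cases "n - Suc k - j")
  \<comment> \<open>Truncated subtraction puts both the leading coefficient
    \<open>j = n - Suc k\<close> and all larger \<open>j\<close> into this case.\<close>
  case 0
  then show ?thesis using assms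
    by (cases "j = n - Suc k") (auto simp: E_def esum_0)
next
  case (Suc s)
  have e: "n - k - Suc j = Suc s" "n - Suc k - j = Suc s" "n - Suc k - Suc j = s"
    "Suc j \<le> n - k" "j \<le> n - Suc k" "Suc j \<le> n - Suc k"
    using Suc by auto
  have "mvar (Suc k) * ((- 1) ^ s * esum {Suc (Suc k)..n} s)
      = (- 1) ^ s * (mvar (Suc k) * (esum {Suc (Suc k)..n} s :: 'a mpol))"
    by (rule central_left_commute[OF central_minus_one_power])
  then show ?thesis
    unfolding E_def e using e(4-6) by (simp add: esum_atLeastAtMost_insert[OF assms] algebra_simps)
qed

lemma E_zero:
  assumes "k < n"
  shows "E k 0 = - mvar (Suc k) * E (Suc k) 0"
proof -
  obtain s where s: "n - k = Suc s" "n - Suc k = s"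
    using assms by (metis Suc_diff_Suc)
  have "mvar (Suc k) * ((- 1) ^ s * esum {Suc (Suc k)..n} s)
      = (- 1) ^ s * (mvar (Suc k) * (esum {Suc (Suc k)..n} s :: 'a mpol))"
    by (rule central_left_commute[OF central_minus_one_power])
  moreover have "esum {Suc (Suc k)..n} (Suc s) = (0 :: 'a mpol)"
    using s by (intro esum_gt_card) auto
  ultimately show ?thesis
    unfolding E_def using s by (simp add: esum_atLeastAtMost_insert[OF assms])
qed

text \<open>Downward from \<open>k = n\<close>, where both polynomials are 1: the recursions for
  \<open>E\<close> and \<open>G\<close> coincide at positive degrees, and at the constant term they
  differ by \<open>\<gamma> k\<close>.\<close>

lemma E_cong_G_if_\<gamma>:
  assumes K: "two_sided K" and "\<And>k. k < n \<Longrightarrow> \<gamma> k \<in> K" and "k \<le> n"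
  shows "E k j - G k j \<in> K"
  using \<open>k \<le> n\<close>
proof (induction k arbitrary: j rule: inc_induct)
  case base
  show ?case by (simp add: E_def G_n esum_0 two_sidedD(1)[OF K])
next
  case (step k)
  show ?case
  proof (cases j)
    case 0
    have "E k j - G k j = - (mvar (Suc k) * (E (Suc k) 0 - G (Suc k) 0)) - \<gamma> k"
      using step.hyps by (simp add: 0 E_zero \<gamma>_def algebra_simps)
    then show ?thesis
      using step assms(2) two_sidedD[OF K] by simp
  next
    case (Suc i)
    have "E k j - G k j = (E (Suc k) i - G (Suc k) i) - mvar (Suc k) * (E (Suc k) (Suc i) - G (Suc k) (Suc i))"
      using step.hyps by (simp add: Suc E_step G_step[of k i] algebra_simps)
    then show ?thesis
      using step two_sidedD[OF K] by simp
  qed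
qed

text \<open>The converse goes upward in \<open>k\<close>. Within one step the coefficients of the
  quotient are compared from the top down, starting at degrees where both vanish; the constant terms
  then put \<open>\<gamma> k\<close> into \<open>K\<close>.\<close>

lemma \<gamma>_if_E_cong_G:
  assumes K: "two_sided K" and 0: "\<And>j. E 0 j - G 0 j \<in> K"
  shows "k < n \<Longrightarrow> \<gamma> k \<in> K"
proof -
  have *: "k \<le> n \<Longrightarrow> E k j - G k j \<in> K" for k j
  proof (induction k arbitrary: j)
    case (Suc k)
    have beyond: "E (Suc k) j - G (Suc k) j \<in> K" if "n \<le> j" for j
      using that Suc.prems n_pos G_eq_0[of "Suc k" j] two_sidedD(1)[OF K] by (auto simp: E_def)
    show ?case
    proof (cases "j \<le> n")
      case True
      then show ?thesis
      proof (induction j rule: inc_induct)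
        case (step j)
        have "E (Suc k) j - G (Suc k) j = (E k (Suc j) - G k (Suc j))
            + mvar (Suc k) * (E (Suc k) (Suc j) - G (Suc k) (Suc j))"
          using Suc.prems by (simp add: E_step G_step[of k j] algebra_simps)
        then show ?case
          using step.IH Suc two_sidedD[OF K] by simp
      qed (rule beyond, simp)
    qed (rule beyond, simp)
  qed (rule 0)
  assume k: "k < n"
  have "\<gamma> k = - ((E k 0 - G k 0) + mvar (Suc k) * (E (Suc k) 0 - G (Suc k) 0))"
    using k by (simp add: E_zero \<gamma>_def algebra_simps)
  also have "\<dots> \<in> K"
    using k by (intro two_sidedD(2,4,5)[OF K] *) auto
  finally show "\<gamma> k \<in> K" .
qed

end

section \<open>The polynomial ring in n variables and its ideals\<close>

lemma carrier_mpoly_ring: "carrier (mpoly_ring n) = {p. in_vars {1..n} p}"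
  by (simp add: mpoly_ring_def in_vars_def)

lemma mpoly_ring_simps:
  "p \<otimes>\<^bsub>mpoly_ring n\<^esub> q = p * q" "p \<oplus>\<^bsub>mpoly_ring n\<^esub> q = p + q"
  "\<zero>\<^bsub>mpoly_ring n\<^esub> = 0" "\<one>\<^bsub>mpoly_ring n\<^esub> = 1"
  by (simp_all add: mpoly_ring_def)

lemma ring_mpoly_ring: "ring (mpoly_ring n :: 'a::ring_1 mpol ring)" (is "ring ?R")
proof (rule ringI)
  show "abelian_group ?R"
  proof (rule abelian_groupI)
    fix x :: "'a mpol" assume "x \<in> carrier (mpoly_ring n)"
    then show "\<exists>y\<in>carrier (mpoly_ring n). y \<oplus>\<^bsub>mpoly_ring n\<^esub> x = \<zero>\<^bsub>mpoly_ring n\<^esub>"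
      by (auto simp: carrier_mpoly_ring mpoly_ring_simps intro!: bexI[of _ "- x"])
  qed (auto simp: carrier_mpoly_ring mpoly_ring_simps algebra_simps)
  show "Group.monoid ?R"
    by (rule monoidI) (auto simp: carrier_mpoly_ring mpoly_ring_simps mult.assoc)
qed (auto simp: carrier_mpoly_ring mpoly_ring_simps algebra_simps)

lemma mpoly_ring_a_inv:
  assumes "in_vars {1..n} p"
  shows "\<ominus>\<^bsub>mpoly_ring n\<^esub> p = - p"
proof -
  interpret ring "mpoly_ring n" by (rule ring_mpoly_ring)
  show ?thesis
    by (rule minus_equality) (use assms in \<open>auto simp: carrier_mpoly_ring mpoly_ring_simps\<close>)
qed

lemma ideal_mpoly_ringI:
  assumes "I \<subseteq> {p. in_vars {1..n} p}" "0 \<in> I"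
    and "\<And>p q. p \<in> I \<Longrightarrow> q \<in> I \<Longrightarrow> p + q \<in> I"
    and "\<And>p q. p \<in> I \<Longrightarrow> in_vars {1..n} q \<Longrightarrow> q * p \<in> I \<and> p * q \<in> I"
  shows "ideal I (mpoly_ring n)"
proof (rule idealI[OF ring_mpoly_ring])
  interpret ring "mpoly_ring n" by (rule ring_mpoly_ring)
  have "- p \<in> I" if "p \<in> I" for p
    using assms(4)[OF that, of "- 1"] by auto
  then show "subgroup I (add_monoid (mpoly_ring n))"
    using assms(1-3)
    by (intro add.subgroupI) (auto simp: carrier_mpoly_ring mpoly_ring_simps mpoly_ring_a_inv subset_iff)
qed (use assms(4) in \<open>auto simp: carrier_mpoly_ring mpoly_ring_simps\<close>)

context central_monic
begin

abbreviation I where "I \<equiv> split_ideal n f"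

definition split_gen :: "nat \<Rightarrow> 'a mpol" where
  "split_gen k = elem_sym n k - mconst ((- 1) ^ k * Polynomial.coeff f (n - k))"

lemma in_vars_esum: "in_vars U (esum U k)"
proof -
  have *: "finite A \<Longrightarrow> Poly_Mapping.keys (\<Sum>i\<in>A. Poly_Mapping.single i 1 :: nat \<Rightarrow>\<^sub>0 nat) \<subseteq> A" for A
    by (auto simp: in_keys_iff lookup_sum lookup_single when_def split: if_splits)
  have **: "Poly_Mapping.keys (\<Sum>i\<in>A. Poly_Mapping.single i 1 :: nat \<Rightarrow>\<^sub>0 nat) \<subseteq> A" for A
    by (cases "finite A") (use * in auto)
  show ?thesis
    unfolding esum_def by (intro in_vars_sum in_vars_single) (use ** in fastforce)
qed

lemma in_vars_split_gen: "in_vars {1..n} (split_gen k)"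
  unfolding split_gen_def elem_sym_eq_esum by (intro in_vars_diff in_vars_esum in_vars_const)

text \<open>The generators of the splitting ideal are, up to sign, the coefficients of the product
  of all \<open>Z - X\<^sub>i\<close> minus those of \<open>f\<close>.\<close>

lemma E_minus_G_eq:
  assumes "j \<le> n"
  shows "E 0 j - G 0 j = (- 1) ^ (n - j) * split_gen (n - j)"
proof -
  have sq: "(- 1) ^ s * (- 1) ^ s = (1::'a mpol)" for s
    by (simp only: power_minus1_even flip: power_add mult_2)
  have m: "mconst ((- 1) ^ s) = ((- 1) ^ s :: 'a mpol)" for s
    by (induction s) (auto simp: mconst_simps)
  have "(- 1) ^ s * (mconst ((- 1) ^ s * c) :: 'a mpol) = mconst c" for s c
    unfolding mconst_simps m using sq[of s] by (simp flip: mult.assoc)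
  then show ?thesis
    using assms by (simp add: E_def split_gen_def elem_sym_eq_esum right_diff_distrib One_nat_def)
qed

lemma split_ideal_eq: "I = genideal (mpoly_ring n) (split_gen ` {1..n})"
  unfolding split_ideal_def split_gen_def by (rule arg_cong[of _ _ "genideal _"]) auto

lemma ideal_I: "ideal I (mpoly_ring n)"
  unfolding split_ideal_eq
  by (rule ring.genideal_ideal[OF ring_mpoly_ring]) (use in_vars_split_gen in \<open>auto simp: carrier_mpoly_ring\<close>)

lemma split_gen_eq:
  assumes "k \<le> n"
  shows "split_gen k = (- 1) ^ k * (E 0 (n - k) - G 0 (n - k))"
proof -
  have "(- 1) ^ k * (- 1) ^ k = (1::'a mpol)"
    by (simp only: power_minus1_even flip: power_add mult_2)
  then show ?thesis
    using E_minus_G_eq[of "n - k"] assms by (simp flip: mult.assoc)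
qed

text \<open>The symmetric relations and the triangular family generate the same ideal: each kind of
  relation follows from the other by the two comparisons of \<open>E\<close> with
  \<open>G\<close>.\<close>

lemma mem_I_iff: "p \<in> I \<longleftrightarrow> in_vars {1..n} p \<and> p \<in> J"
proof
  have "split_gen k \<in> J" if "k \<in> {1..n}" for k
    using that E_cong_G_if_\<gamma>[OF two_sided_J \<gamma>_in_J, of 0]
    by (simp add: split_gen_eq two_sidedD[OF two_sided_J])
  moreover have "ideal ({p. in_vars {1..n} p} \<inter> J) (mpoly_ring n)"
    by (rule ideal_mpoly_ringI) (auto simp: two_sidedD[OF two_sided_J])
  ultimately have "I \<subseteq> {p. in_vars {1..n} p} \<inter> J"
    unfolding split_ideal_eq
    by (intro ring.genideal_minimal[OF ring_mpoly_ring]) (auto simp: in_vars_split_gen)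
  then show "p \<in> I \<Longrightarrow> in_vars {1..n} p \<and> p \<in> J" by auto
next
  interpret ideal I "mpoly_ring n" by (rule ideal_I)
  \<comment> \<open>The preimage of \<open>I\<close> under the retraction is a two-sided ideal of
    the polynomials in all variables, as \<open>\<gamma>_if_E_cong_G\<close> requires, and it agrees
    with \<open>I\<close> on polynomials in the first \<open>n\<close> variables.\<close>
  let ?K = "{p. restr {1..n} p \<in> I}"
  have K: "two_sided ?K"
    unfolding two_sided_def
    using additive_subgroup.zero_closed[OF is_additive_subgroup] I_l_closed I_r_closed
      additive_subgroup.a_closed[OF is_additive_subgroup]
    by (auto simp: restr_0 restr_add restr_mult mpoly_ring_simps carrier_mpoly_ring in_vars_restr)
  have gen: "split_gen k \<in> ?K" if "k \<in> {1..n}" for k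
  proof -
    have "split_gen ` {1..n} \<subseteq> I"
      unfolding split_ideal_eq
      by (rule ring.genideal_self[OF ring_mpoly_ring]) (auto simp: carrier_mpoly_ring in_vars_split_gen)
    then show ?thesis
      using that in_vars_split_gen by (auto simp: restr_ident)
  qed
  have "E 0 j - G 0 j \<in> ?K" for j
  proof (cases "j < n")
    case True
    then show ?thesis
      unfolding E_minus_G_eq[OF less_imp_le[OF True]]
      by (intro two_sidedD(4)[OF K] gen) auto
  next
    case False
    then show ?thesis
      using two_sidedD(1)[OF K] G_eq_0[of 0 j] G_lead[of 0]
      by (cases "j = n") (auto simp: E_def esum_0)
  qed
  then have "\<gamma> k \<in> ?K" if "k < n" for k
    using \<gamma>_if_E_cong_G[OF K] that by blast
  then have "(\<Sum>k<n. u k * \<gamma> k) \<in> ?K" for u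
    by (intro two_sided_sum[OF K] two_sidedD(4)[OF K]) simp
  then have "J \<subseteq> ?K"
    unfolding J_def by blast
  then show "in_vars {1..n} p \<and> p \<in> J \<Longrightarrow> p \<in> I"
    by (auto simp: restr_ident dest!: subsetD)
qed

end


section \<open>Left multiplications modulo the ideal\<close>

lemma sum_mult_lessThan: "(\<Sum>p<m * d. h p) = (\<Sum>p<m. \<Sum>a<d. h (p * d + a))" for d :: nat
proof -
  have "(\<Sum>p<m. \<Sum>a<d. h (p * d + a)) = (\<Sum>p<m. sum h {p * d..<p * d + d})"
  proof (rule sum.cong)
    fix p
    show "(\<Sum>a<d. h (p * d + a)) = sum h {p * d..<p * d + d}"
      using sum.shift_bounds_nat_ivl[of h 0 "p * d" d] by (simp add: atLeast0LessThan add.commute)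
  qed simp
  then show ?thesis by (simp add: sum.nat_group)
qed

context central_monic
begin

section \<open>Computing modulo the ideal\<close>

abbreviation congr :: "'a mpol \<Rightarrow> 'a mpol \<Rightarrow> bool" (infix "\<doteq>" 50) where
  "x \<doteq> y \<equiv> cong_ideal J x y"

lemmas congr_refl = cong_ideal_refl[OF two_sided_J]
  and congr_sym = cong_ideal_sym[OF two_sided_J]
  and congr_trans [trans] = cong_ideal_trans[OF two_sided_J]
  and congr_add = cong_ideal_add[OF two_sided_J]
  and congr_diff = cong_ideal_diff[OF two_sided_J]
  and congr_uminus = cong_ideal_uminus[OF two_sided_J]
  and congr_multL = cong_ideal_multL[OF two_sided_J]
  and congr_multR = cong_ideal_multR[OF two_sided_J]
  and congr_sum = cong_ideal_sum[OF two_sided_J]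

lemma congr_eq_trans [trans]: "x = y \<Longrightarrow> y \<doteq> z \<Longrightarrow> x \<doteq> z" "x \<doteq> y \<Longrightarrow> y = z \<Longrightarrow> x \<doteq> z"
  by simp_all

lemma \<gamma>_congr_0: "k < n \<Longrightarrow> \<gamma> k \<doteq> 0"
  by (simp add: cong_ideal_def \<gamma>_in_J)

text \<open>
  The entry in row \<open>a\<close> and column \<open>t\<close> (counted from 0) of \<open>g\<^sub>k\<^sup>[\<^sup>j\<^sup>](C)\<close>, where \<open>C\<close> is the companion
  matrix of \<open>g\<^sub>k\<close>.
\<close>

definition bracket_entry :: "nat \<Rightarrow> nat \<Rightarrow> nat \<Rightarrow> nat \<Rightarrow> 'a mpol" where
  "bracket_entry k j a t = (if t \<le> j then (if t \<le> a then G k (j + 1 + a - t) else 0)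
     else (if a < t \<and> t \<le> a + j + 1 then - G k (a + j + 1 - t) else 0))"

definition companion_entry :: "nat \<Rightarrow> nat \<Rightarrow> nat \<Rightarrow> 'a mpol" where
  "companion_entry k a t = (if t = n - k - 1 then - G k a else if a = Suc t then 1 else 0)"

text \<open>The coefficients of \<open>g\<^sub>k\<^sub>+\<^sub>1\<close> are the values of
  \<open>g\<^sub>k\<^sup>[\<^sup>j\<^sup>]\<close> at \<open>mvar (Suc k)\<close>, and this is their
  matrix on its powers. By \<open>G_step\<close>, each factor \<open>mvar (Suc k)\<close> turns
  coefficient \<open>j\<close> into coefficient \<open>j - 1\<close> minus a coefficient of
  \<open>g\<^sub>k\<close>; at \<open>j = 0\<close> the relation \<open>\<gamma> k\<close> takes
  over.\<close>

lemma G_Suc_mult_power: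
  assumes "k < n" "t < n - k"
  shows "G (Suc k) j * mvar (Suc k) ^ t \<doteq> (\<Sum>a<n - k. mvar (Suc k) ^ a * bracket_entry k j a t)"
  using assms(2)
proof (induction t arbitrary: j)
  case 0
  have "G (Suc k) j = (\<Sum>a<n. mvar (Suc k) ^ a * G k (j + 1 + a))"
    by (simp add: G.simps(2) centralD[OF central_G])
  also have "\<dots> = (\<Sum>a<n - k. mvar (Suc k) ^ a * G k (j + 1 + a))"
    by (rule sum.mono_neutral_right) (auto simp: G_eq_0)
  finally show ?case by (simp add: bracket_entry_def congr_refl)
next
  case (Suc t)
  let ?X = "mvar (Suc k) :: 'a mpol"
  show ?case
  proof (cases j)
    case 0
    have "G (Suc k) 0 * ?X ^ Suc t = ?X ^ t * (?X * G (Suc k) 0)"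
      by (simp only: centralD[OF central_G] power_Suc2 mult.assoc)
    then have "G (Suc k) 0 * ?X ^ Suc t = ?X ^ t * \<gamma> k - ?X ^ t * G k 0"
      by (simp add: \<gamma>_def distrib_left)
    also have "\<dots> \<doteq> ?X ^ t * 0 - ?X ^ t * G k 0"
      using assms(1) by (intro congr_diff congr_multL \<gamma>_congr_0 congr_refl)
    also have "?X ^ t * 0 - ?X ^ t * G k 0 = (\<Sum>a<n - k. if a = t then - (?X ^ a * G k 0) else 0)"
      using Suc.prems by simp
    also have "\<dots> = (\<Sum>a<n - k. ?X ^ a * bracket_entry k j a (Suc t))"
      by (rule sum.cong) (auto simp: 0 bracket_entry_def)
    finally show ?thesis by (simp add: 0)
  next
    case (Suc i)
    have "G (Suc k) (Suc i) * ?X ^ Suc t = G (Suc k) i * ?X ^ t - ?X ^ t * G k (Suc i)"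
      by (simp add: G_step[of k i] algebra_simps centralD[OF central_G] power_commutes flip: mult.assoc)
    also have "\<dots> \<doteq> (\<Sum>a<n - k. ?X ^ a * bracket_entry k i a t) - ?X ^ t * G k (Suc i)"
      using Suc.prems by (intro congr_diff Suc.IH congr_refl) auto
    also have "\<dots> = (\<Sum>a<n - k. ?X ^ a * bracket_entry k i a t) - (\<Sum>a<n - k. if a = t then ?X ^ a * G k (Suc i) else 0)"
      using Suc.prems by simp
    also have "\<dots> = (\<Sum>a<n - k. ?X ^ a * bracket_entry k (Suc i) a (Suc t))"
      unfolding sum_subtractf[symmetric] by (rule sum.cong) (auto simp: bracket_entry_def Suc_diff_le One_nat_def)
    finally show ?thesis by (simp add: Suc)
  qed
qed

text \<open>Only the top power leaves the range; \<open>\<gamma> k\<close> rewrites it by lower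
  powers, which gives the last column.\<close>

lemma mvar_mult_power:
  assumes "k < n" "t < n - k"
  shows "mvar (Suc k) * mvar (Suc k) ^ t \<doteq> (\<Sum>a<n - k. mvar (Suc k) ^ a * companion_entry k a t)"
proof (cases "t = n - k - 1")
  case True
  let ?X = "mvar (Suc k) :: 'a mpol"
  have "Suc t = n - k"
    using assms True by simp
  then have "?X * ?X ^ t = \<gamma> k - (\<Sum>a<n - k. ?X ^ a * G k a)"
    using \<gamma>_eq_sum[OF assms(1)] by (simp flip: power_Suc)
  also have "\<dots> \<doteq> 0 - (\<Sum>a<n - k. ?X ^ a * G k a)"
    using assms(1) by (intro congr_diff \<gamma>_congr_0 congr_refl)
  also have "\<dots> = (\<Sum>a<n - k. ?X ^ a * companion_entry k a t)"
    using True by (simp add: companion_entry_def sum_negf)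
  finally show ?thesis .
next
  case False
  then have "(\<Sum>a<n - k. mvar (Suc k) ^ a * companion_entry k a t)
      = (\<Sum>a<n - k. if a = Suc t then mvar (Suc k) ^ a else 0)"
    by (intro sum.cong) (auto simp: companion_entry_def)
  also have "\<dots> = mvar (Suc k) * mvar (Suc k) ^ t"
    using False assms by auto
  finally show ?thesis by (simp add: congr_refl)
qed

section \<open>The enumeration of the basis monomials\<close>

text \<open>The exponents are the digits of \<open>q\<close> in the mixed radix
  \<open>n - k\<close>, \<open>n - k - 1\<close>, and so on, least significant first. The exponent
  of the first variable thus varies fastest, as in the prescribed order of the basis.\<close>

primrec expo :: "nat \<Rightarrow> nat \<Rightarrow> nat \<Rightarrow> (nat \<Rightarrow>\<^sub>0 nat)" where
  "expo k 0 q = 0"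
| "expo k (Suc m) q = Poly_Mapping.single (Suc k) (q mod (n - k)) + expo (Suc k) m (q div (n - k))"

lemma lookup_expo_le: "i \<le> k \<Longrightarrow> Poly_Mapping.lookup (expo k m q) i = 0"
  by (induction m arbitrary: k q) (auto simp: lookup_add lookup_single when_def)

lemma lookup_expo_gt: "k + m < i \<Longrightarrow> Poly_Mapping.lookup (expo k m q) i = 0"
  by (induction m arbitrary: k q) (auto simp: lookup_add lookup_single when_def)

lemma lookup_expo_Suc: "m > 0 \<Longrightarrow> Poly_Mapping.lookup (expo k m q) (Suc k) = q mod (n - k)"
  by (cases m) (auto simp: lookup_add lookup_expo_le)

lemma lookup_expo_less: "l < n \<Longrightarrow> Poly_Mapping.lookup (expo k m q) (Suc l) < n - l"
  by (induction m arbitrary: k q) (auto simp: lookup_add lookup_single when_def lookup_expo_le)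

lemma bounded_expo: "bounded (expo k m q)"
  by (simp add: bounded_def lookup_expo_less)

lemma fact_diff: "k < n \<Longrightarrow> fact (n - k) = fact (n - Suc k) * (n - k)"
  by (metis Suc_diff_Suc diff_Suc_eq_diff_pred fact_Suc mult.commute of_nat_id)

text \<open>The lowest digit gives the remainder of \<open>q\<close> modulo \<open>n - k\<close>,
  and by induction the other digits give the quotient.\<close>

lemma inj_expo: "k \<le> n \<Longrightarrow> inj_on (expo k (n - k)) {..<fact (n - k)}"
proof (induction k rule: inc_induct)
  case base
  then show ?case by (auto simp: inj_on_def One_nat_def)
next
  case (step k)
  have m: "n - k = Suc (n - Suc k)" using step.hyps by simp
  show ?case
  proof (rule inj_onI)
    fix p q assume pq: "p \<in> {..<fact (n - k)}" "q \<in> {..<fact (n - k)}" "expo k (n - k) p = expo k (n - k) q"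
    then have mod: "p mod (n - k) = q mod (n - k)"
      using lookup_expo_Suc[of "n - k" k p] lookup_expo_Suc[of "n - k" k q] step.hyps by simp
    then have "expo (Suc k) (n - Suc k) (p div (n - k)) = expo (Suc k) (n - Suc k) (q div (n - k))"
      using pq(3) unfolding m expo.simps by simp
    moreover have "p div (n - k) < fact (n - Suc k)" "q div (n - k) < fact (n - Suc k)"
      using pq(1,2) step.hyps by (simp_all add: fact_diff less_mult_imp_div_less)
    ultimately have "p div (n - k) = q div (n - k)"
      using step.IH by (auto dest: inj_onD)
    then show "p = q"
      using mod by (metis div_mult_mod_eq)
  qed
qed

text \<open>For \<open>q < fact (n - k)\<close> these represent the basis over
  \<open>R[r\<^sub>1, \<dots>, r\<^sub>k]\<close>; all these bases live in one ring.\<close>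

definition bas :: "nat \<Rightarrow> nat \<Rightarrow> 'a mpol" where
  "bas k q = mon (expo k (n - k) q)"

lemma bas_step:
  assumes "k < n"
  shows "bas k q = mvar (Suc k) ^ (q mod (n - k)) * bas (Suc k) (q div (n - k))"
proof -
  have m: "n - k = Suc (n - Suc k)" using assms by simp
  have "expo k (n - k) q
      = Poly_Mapping.single (Suc k) (q mod (n - k)) + expo (Suc k) (n - Suc k) (q div (n - k))"
    by (subst m) simp
  then show ?thesis by (simp add: bas_def mon_add mvar_power)
qed

lemma bas_mult_add:
  assumes "k < n" "a < n - k"
  shows "bas k (p * (n - k) + a) = mvar (Suc k) ^ a * bas (Suc k) p"
  using assms by (subst bas_step) auto

text \<open>
  If \<open>u\<close> acts on the basis over \<open>R[X\<^sub>1, \<dots>, X\<^sub>k\<^sub>+\<^sub>1]\<close> with coefficients \<open>e\<close>, then its coefficients over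
  \<open>R[X\<^sub>1, \<dots>, X\<^sub>k]\<close> arise by replacing each \<open>e\<close> by the matrix of the multiplication by \<open>e\<close>.
\<close>

lemma lift_block:
  assumes "k < n" "t < n - k"
    and "u * bas (Suc k) q \<doteq> (\<Sum>p<fact (n - Suc k). bas (Suc k) p * e p)"
    and "\<And>p. p < fact (n - Suc k) \<Longrightarrow> e p * mvar (Suc k) ^ t \<doteq> (\<Sum>a<n - k. mvar (Suc k) ^ a * c p a)"
  shows "u * bas k (q * (n - k) + t) \<doteq> (\<Sum>p<fact (n - k). bas k p * c (p div (n - k)) (p mod (n - k)))"
proof -
  let ?X = "mvar (Suc k) :: 'a mpol"
  have X: "central (?X ^ t)" and Xa: "central (?X ^ a)" for a by simp_all
  have "u * bas k (q * (n - k) + t) = (u * bas (Suc k) q) * ?X ^ t"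
    using assms(1,2) by (simp add: bas_mult_add centralD[OF X] mult.assoc)
  also have "\<dots> \<doteq> (\<Sum>p<fact (n - Suc k). bas (Suc k) p * e p) * ?X ^ t"
    by (intro congr_multR assms(3))
  also have "\<dots> = (\<Sum>p<fact (n - Suc k). bas (Suc k) p * (e p * ?X ^ t))"
    by (simp add: sum_distrib_right mult.assoc)
  also have "\<dots> \<doteq> (\<Sum>p<fact (n - Suc k). bas (Suc k) p * (\<Sum>a<n - k. ?X ^ a * c p a))"
    by (intro congr_sum congr_multL assms(4)) simp
  also have "\<dots> = (\<Sum>p<fact (n - Suc k). \<Sum>a<n - k. bas k (p * (n - k) + a) * c p a)"
    using assms(1) by (simp add: sum_distrib_left bas_mult_add centralD[OF Xa] mult.assoc)
  also have "\<dots> = (\<Sum>p<fact (n - Suc k) * (n - k). bas k p * c (p div (n - k)) (p mod (n - k)))"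
    unfolding sum_mult_lessThan by simp
  finally show ?thesis by (simp add: fact_diff[OF assms(1)])
qed

text \<open>Over \<open>R[X\<^sub>1, \<dots>, X\<^sub>k\<^sub>+\<^sub>1]\<close> the variable is a
  scalar, so over \<open>R[X\<^sub>1, \<dots>, X\<^sub>k]\<close> its matrix is block diagonal, with
  the companion matrix of \<open>g\<^sub>k\<close> in each block.\<close>

lemma lift_block_X:
  assumes "k < n" "t < n - k" "q < fact (n - Suc k)"
  shows "mvar (Suc k) * bas k (q * (n - k) + t)
    \<doteq> (\<Sum>p<fact (n - k). bas k p * (if p div (n - k) = q then companion_entry k (p mod (n - k)) t else 0))"
proof (rule lift_block[OF assms(1,2)])
  have "(\<Sum>p<fact (n - Suc k). bas (Suc k) p * (if p = q then mvar (Suc k) else 0)) = mvar (Suc k) * bas (Suc k) q"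
    using assms(3) by (simp add: if_distrib[of "\<lambda>x. _ * x"] centralD[OF central_mvar] cong: if_cong)
  then show "mvar (Suc k) * bas (Suc k) q
      \<doteq> (\<Sum>p<fact (n - Suc k). bas (Suc k) p * (if p = q then mvar (Suc k) else 0))"
    by (simp add: congr_refl)
qed (use mvar_mult_power[OF assms(1,2)] congr_refl in auto)

definition coeffs_pm :: "nat \<Rightarrow> 'a mpol set" where
  "coeffs_pm k = range (G k) \<union> uminus ` range (G k)"

lemma coeffs_pm_closed [simp]: "0 \<in> coeffs_pm k" "G k j \<in> coeffs_pm k" "- G k j \<in> coeffs_pm k"
  "x \<in> coeffs_pm k \<Longrightarrow> - x \<in> coeffs_pm k" "k \<le> n \<Longrightarrow> 1 \<in> coeffs_pm k"
proof -
  have "G k (Suc n) = 0" by (simp add: G_eq_0)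
  then show "0 \<in> coeffs_pm k" unfolding coeffs_pm_def by (metis UnI1 rangeI)
  show "k \<le> n \<Longrightarrow> 1 \<in> coeffs_pm k" unfolding coeffs_pm_def by (metis UnI1 rangeI G_lead)
qed (auto simp: coeffs_pm_def)

text \<open>The shape of the entries survives the passage from \<open>k + 1\<close> to
  \<open>k\<close>: a signed coefficient of \<open>g\<^sub>k\<^sub>+\<^sub>1\<close> becomes a block
  of signed coefficients of \<open>g\<^sub>k\<close>.\<close>

lemma coeffs_pm_mult_power:
  assumes "k < n" "t < n - k" "x \<in> coeffs_pm (Suc k)"
  shows "\<exists>c. range c \<subseteq> coeffs_pm k \<and> x * mvar (Suc k) ^ t \<doteq> (\<Sum>a<n - k. mvar (Suc k) ^ a * c a)"
proof -
  obtain j where "x = G (Suc k) j \<or> x = - G (Suc k) j"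
    using assms(3) by (auto simp: coeffs_pm_def)
  then show ?thesis
  proof
    assume x: "x = G (Suc k) j"
    show ?thesis
      unfolding x by (rule exI[of _ "\<lambda>a. bracket_entry k j a t"]) (use G_Suc_mult_power[OF assms(1,2)] in \<open>auto simp: bracket_entry_def\<close>)
  next
    assume x: "x = - G (Suc k) j"
    show ?thesis
      unfolding x using congr_uminus[OF G_Suc_mult_power[OF assms(1,2), of j]]
      by (intro exI[of _ "\<lambda>a. - bracket_entry k j a t"]) (auto simp: bracket_entry_def sum_negf)
  qed
qed

text \<open>Downward induction from \<open>k = n\<close>, where no variable is left. Each step adds
  one variable, which acts by companion blocks, while the matrices of the later variables are lifted
  blockwise. The cases \<open>k = 1\<close> and \<open>k = 0\<close> give the entries over
  \<open>R[r\<^sub>1]\<close> and over \<open>R\<close>.\<close>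

lemma mvar_mult_bas:
  assumes "k \<le> n" "i \<in> {Suc k..n}" "q < fact (n - k)"
  shows "\<exists>e. range e \<subseteq> coeffs_pm k \<and> mvar i * bas k q \<doteq> (\<Sum>p<fact (n - k). bas k p * e p)"
  using assms
proof (induction k arbitrary: q rule: inc_induct)
  case base
  then show ?case by simp
next
  case (step k)
  define q' t where "q' = q div (n - k)" and "t = q mod (n - k)"
  have q: "q = q' * (n - k) + t" "t < n - k" "q' < fact (n - Suc k)"
    using step.prems(2) step.hyps by (simp_all only: q'_def t_def fact_diff less_mult_imp_div_less div_mult_mod_eq) simp
  show ?case
  proof (cases "i = Suc k")
    case True
    show ?thesis
      unfolding True q(1)
      by (rule exI, rule conjI[OF _ lift_block_X[OF _ q(2,3)]])
        (use step.hyps in \<open>auto simp: companion_entry_def\<close>)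
  next
    case False
    then obtain e where e: "range e \<subseteq> coeffs_pm (Suc k)"
      "mvar i * bas (Suc k) q' \<doteq> (\<Sum>p<fact (n - Suc k). bas (Suc k) p * e p)"
      using step.IH[OF _ q(3)] step.prems by auto
    have "\<forall>p. \<exists>c. range c \<subseteq> coeffs_pm k
        \<and> e p * mvar (Suc k) ^ t \<doteq> (\<Sum>a<n - k. mvar (Suc k) ^ a * c a)"
      using e(1) by (intro allI coeffs_pm_mult_power step.hyps q(2)) auto
    from choice[OF this] obtain c where c: "\<And>p. range (c p) \<subseteq> coeffs_pm k"
        "\<And>p. e p * mvar (Suc k) ^ t \<doteq> (\<Sum>a<n - k. mvar (Suc k) ^ a * c p a)"
      by blast
    have "mvar i * bas k q \<doteq> (\<Sum>p<fact (n - k). bas k p * c (p div (n - k)) (p mod (n - k)))"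
      unfolding q(1) by (rule lift_block[OF _ q(2) e(2) c(2)]) (rule step.hyps)
    then show ?thesis
      using c(1) by (intro exI[of _ "\<lambda>p. c (p div (n - k)) (p mod (n - k))"]) auto
  qed
qed

section \<open>Uniqueness of coefficients modulo the ideal\<close>

lemma mult_power_congr_unique:
  assumes "(\<Sum>a<n. mvar 1 ^ a * mconst (c a)) \<doteq> (\<Sum>a<n. mvar 1 ^ a * mconst (d a))" "a < n"
  shows "c a = d a"
proof -
  have "(\<Sum>a<n. mon (Poly_Mapping.single 1 a) * mconst (c a - d a)) \<in> J"
    using assms(1) by (simp add: cong_ideal_def mvar_power mconst_simps right_diff_distrib sum_subtractf)
  then have "c a - d a = 0"
    by (rule independent_mod_J[rotated 3])
      (use assms(2) in \<open>auto intro!: inj_onI simp: bounded_def lookup_single when_def dest: injD[OF inj_single]\<close>)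
  then show ?thesis by simp
qed

lemma bas_congr_unique:
  assumes "(\<Sum>q<fact n. bas 0 q * mconst (c q)) \<doteq> (\<Sum>q<fact n. bas 0 q * mconst (d q))" "q < fact n"
  shows "c q = d q"
proof -
  have "(\<Sum>q<fact n. mon (expo 0 n q) * mconst (c q - d q)) \<in> J"
    using assms(1) by (simp add: cong_ideal_def bas_def mconst_simps right_diff_distrib sum_subtractf)
  then have "c q - d q = 0"
    by (rule independent_mod_J[rotated 3])
      (use assms(2) inj_expo[of 0] bounded_expo in auto)
  then show ?thesis by simp
qed

end


section \<open>Passage to the splitting ring\<close>

lemma concat_map_upt:
  "concat (map (\<lambda>e. map (\<lambda>q. h (e * L + q)) [0..<L]) [0..<d]) = map h [0..<d * L]"
proof (induction d)
  case (Suc d)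
  have "map h [d * L..<Suc d * L] = map (\<lambda>q. h (d * L + q)) [0..<L]"
    by (rule nth_equalityI) auto
  moreover have "[0..<Suc d * L] = [0..<d * L] @ [d * L..<Suc d * L]"
    using upt_add_eq_append[of 0 "d * L" L] by (simp add: add.commute)
  ultimately show ?case using Suc by simp
qed simp

lemma filter_mod_upt:
  assumes "d > 0"
  shows "filter (\<lambda>q. q mod d = 0) [0..<m * d] = map (\<lambda>p. p * d) [0..<m]"
proof (induction m)
  case (Suc m)
  have "[m * d..<Suc m * d] = m * d # [Suc (m * d)..<Suc m * d]"
    using assms by (simp add: upt_conv_Cons)
  moreover have "filter (\<lambda>q. q mod d = 0) [Suc (m * d)..<Suc m * d] = []"
  proof -
    have "q mod d \<noteq> 0" if q: "Suc (m * d) \<le> q" "q < Suc m * d" for q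
    proof
      assume "q mod d = 0"
      then obtain x where "q = d * x" by (auto elim: dvdE)
      then have "m < x" "x < Suc m"
        using q by (metis Suc_le_lessD mult.commute mult_less_cancel2, metis mult.commute mult_less_cancel2)
      then show False by simp
    qed
    then show ?thesis by (auto simp: filter_empty_conv)
  qed
  moreover have "[0..<Suc m * d] = [0..<m * d] @ [m * d..<Suc m * d]"
    using upt_add_eq_append[of 0 "m * d" d] by (simp add: add.commute)
  ultimately show ?case using Suc by simp
qed simp

lemma lookup_sum_list_single:
  "distinct xs \<Longrightarrow> Poly_Mapping.lookup (sum_list (map (\<lambda>i. Poly_Mapping.single i (\<alpha> i)) xs)) i
    = (if i \<in> set xs then \<alpha> i else (0::nat))"
  by (induction xs) (auto simp: lookup_add lookup_single when_def)

context central_monic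
begin

section \<open>The projection onto the splitting ring\<close>

abbreviation T where "T \<equiv> split_ring n f"

abbreviation iv :: "'a mpol \<Rightarrow> bool" where "iv \<equiv> in_vars {1..n}"

definition pr :: "'a mpol \<Rightarrow> 'a mpol set" where
  "pr p = I +>\<^bsub>mpoly_ring n\<^esub> p"

lemma split_root_eq: "split_root n f i = pr (mvar i)"
  by (simp add: split_root_def pr_def)

lemma emb_eq: "emb n f a = pr (mconst a)"
  by (simp add: emb_def pr_def)

lemma ring_T: "ring T"
  unfolding split_ring_def by (rule ideal.quotient_is_ring[OF ideal_I])

lemma pr_hom: "pr \<in> Ring.ring_hom (mpoly_ring n) T"
  using ideal.rcos_ring_hom[OF ideal_I] unfolding split_ring_def pr_def[abs_def] .

lemma pr_carrier [simp]: "iv p \<Longrightarrow> pr p \<in> carrier T"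
  using Ring.ring_hom_closed[OF pr_hom, of p] by (simp add: carrier_mpoly_ring)

lemma pr_add: "iv p \<Longrightarrow> iv q \<Longrightarrow> pr (p + q) = pr p \<oplus>\<^bsub>T\<^esub> pr q"
  using Ring.ring_hom_add[OF pr_hom, of p q] by (simp add: carrier_mpoly_ring mpoly_ring_simps)

lemma pr_mult: "iv p \<Longrightarrow> iv q \<Longrightarrow> pr (p * q) = pr p \<otimes>\<^bsub>T\<^esub> pr q"
  using Ring.ring_hom_mult[OF pr_hom, of p q] by (simp add: carrier_mpoly_ring mpoly_ring_simps)

lemma pr_1: "pr 1 = \<one>\<^bsub>T\<^esub>"
  using Ring.ring_hom_one[OF pr_hom] by (simp add: mpoly_ring_simps)

lemma pr_0: "pr 0 = \<zero>\<^bsub>T\<^esub>"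
  using Ring.ring_hom_zero[OF pr_hom ring_mpoly_ring ring_T] by (simp add: mpoly_ring_simps)

lemma pr_uminus:
  assumes "iv p"
  shows "pr (- p) = \<ominus>\<^bsub>T\<^esub> pr p"
proof -
  interpret ring T by (rule ring_T)
  show ?thesis
    using assms pr_add[of "- p" p] by (intro minus_equality[symmetric]) (auto simp: pr_0)
qed

lemma pr_power:
  assumes "iv p"
  shows "pr (p ^ k) = pr p [^]\<^bsub>T\<^esub> k"
proof -
  interpret ring T by (rule ring_T)
  show ?thesis
    using assms by (induction k) (auto simp: pr_1 power_Suc2 pr_mult simp del: power_Suc)
qed

lemma pr_sum:
  assumes "\<And>i. i \<in> A \<Longrightarrow> iv (g i)"
  shows "pr (sum g A) = (\<Oplus>\<^bsub>T\<^esub>i\<in>A. pr (g i))"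
proof -
  interpret ring T by (rule ring_T)
  show ?thesis
    using assms by (induction A rule: infinite_finite_induct) (auto simp: pr_0 pr_add)
qed

text \<open>Turns equations in the quotient ring into congruences modulo \<open>J\<close>, where
  \<open>I\<close> and \<open>J\<close> contain the same polynomials in the first \<open>n\<close>
  variables.\<close>

lemma pr_eq_iff:
  assumes "iv p" "iv q"
  shows "pr p = pr q \<longleftrightarrow> p \<doteq> q"
proof -
  interpret ring "mpoly_ring n :: 'a mpol ring" by (rule ring_mpoly_ring)
  have "p \<ominus>\<^bsub>mpoly_ring n\<^esub> q = p - q"
    using assms by (simp add: a_minus_def mpoly_ring_a_inv mpoly_ring_simps)
  then show ?thesis
    using quotient_eq_iff_same_a_r_cos[OF ideal_I, of p q] assms
    by (simp add: pr_def carrier_mpoly_ring cong_ideal_def mem_I_iff)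
qed

lemma iv_mvar [simp]: "i \<in> {1..n} \<Longrightarrow> iv (mvar i)"
  by (rule in_vars_mvar)

lemma iv_expo: "k + m \<le> n \<Longrightarrow> iv (Poly_Mapping.single (expo k m q) a)"
proof (rule in_vars_single, rule subsetI)
  fix i assume *: "k + m \<le> n" "i \<in> Poly_Mapping.keys (expo k m q)"
  have "\<not> i \<le> k" "\<not> k + m < i"
    using *(2) lookup_expo_le[of i k m q] lookup_expo_gt[of k m i q] by (auto simp: in_keys_iff)
  then show "i \<in> {1..n}"
    using *(1) by auto
qed

lemma iv_bas [simp]: "k \<le> n \<Longrightarrow> iv (bas k q)"
  unfolding bas_def by (rule iv_expo) simp

lemma iv_G [simp]: "k \<le> n \<Longrightarrow> iv (G k j)"
  by (rule in_vars_mono[OF in_vars_G]) auto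

lemma mon_congr_unique:
  assumes "bounded \<alpha>" "bounded \<beta>" "mon \<alpha> \<doteq> mon \<beta>"
  shows "\<alpha> = \<beta>"
proof -
  have *: "bounded \<delta> \<Longrightarrow> normal n (mon \<delta>) = mon \<delta>" for \<delta>
    by (simp add: bounded_def normal_single_ident)
  have "mon \<alpha> = normal n ((mon \<alpha> - mon \<beta>) + mon \<beta>)"
    using * assms(1) by simp
  also have "\<dots> = mon \<beta>"
    using assms(2,3) * unfolding normal_add by (simp add: normal_J cong_ideal_def)
  finally have "Poly_Mapping.keys (mon \<alpha> :: 'a mpol) = Poly_Mapping.keys (mon \<beta> :: 'a mpol)"
    by simp
  then show ?thesis by simp
qed

text \<open>\<open>expo\<close> splits off the least significant digit, whereas
  \<open>s\<^sub>m\<^sub>+\<^sub>1\<close> arises from \<open>s\<^sub>m\<close> by adding the most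
  significant one. The product counts the values of the first \<open>m\<close> digits, so it is the
  weight of the new digit.\<close>

lemma expo_snoc:
  "e < n - k - m \<Longrightarrow> q < (\<Prod>i<m. n - k - i) \<Longrightarrow>
    expo k (Suc m) (e * (\<Prod>i<m. n - k - i) + q) = expo k m q + Poly_Mapping.single (Suc (k + m)) e"
proof (induction m arbitrary: k q)
  case 0
  then show ?case by simp
next
  case (Suc m)
  let ?L = "\<Prod>i<m. n - Suc k - i"
  have L: "(\<Prod>i<Suc m. n - k - i) = (n - k) * ?L"
    by (subst prod.lessThan_Suc_shift) simp
  have pos: "n - k > 0" using Suc.prems(1) by simp
  have q: "q div (n - k) < ?L"
    using Suc.prems(2) unfolding L by (simp add: less_mult_imp_div_less mult.commute)
  have "expo k (Suc (Suc m)) (e * ((n - k) * ?L) + q)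
      = Poly_Mapping.single (Suc k) (q mod (n - k)) + expo (Suc k) (Suc m) (e * ?L + q div (n - k))"
  proof -
    have "(e * ((n - k) * ?L) + q) mod (n - k) = q mod (n - k)"
      "(e * ((n - k) * ?L) + q) div (n - k) = e * ?L + q div (n - k)"
      using pos div_mult_self1[of "n - k" q "e * ?L"] mod_mult_self1[of q "e * ?L" "n - k"]
      by (simp_all add: mult.left_commute mult.commute add.commute)
    then show ?thesis unfolding expo.simps(2)[of k "Suc m"] by simp
  qed
  also have "expo (Suc k) (Suc m) (e * ?L + q div (n - k))
      = expo (Suc k) m (q div (n - k)) + Poly_Mapping.single (Suc (Suc k + m)) e"
    using Suc.prems(1) q by (intro Suc.IH) auto
  finally show ?case unfolding L by (simp add: add.assoc)
qed

section \<open>The ordered bases over R and over its extension by the first root\<close>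

lemma basis_seq_eq:
  "m \<le> n \<Longrightarrow> basis_seq n f m = map (\<lambda>q. pr (mon (expo 0 m q))) [0..<(\<Prod>i<m. n - i)]"
proof (induction m)
  case 0
  then show ?case by (simp add: pr_1 One_nat_def)
next
  case (Suc m)
  let ?L = "\<Prod>i<m. n - i"
  have "basis_seq n f (Suc m)
      = concat (map (\<lambda>e. map (\<lambda>q. pr (mon (expo 0 (Suc m) (e * ?L + q)))) [0..<?L]) [0..<n - m])"
    unfolding basis_seq.simps
  proof (rule arg_cong[of _ _ concat], rule map_cong)
    fix e assume e: "e \<in> set [0..<n - m]"
    have "pr (mon (expo 0 m q)) \<otimes>\<^bsub>T\<^esub> split_root n f (Suc m) [^]\<^bsub>T\<^esub> e = pr (mon (expo 0 (Suc m) (e * ?L + q)))"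
      if "q < ?L" for q
    proof -
      have iv: "iv (mon (expo 0 m q))" "iv (mvar (Suc m))"
        using Suc.prems by (auto intro: iv_expo)
      have eq: "mon (expo 0 (Suc m) (e * ?L + q)) = mon (expo 0 m q) * (mvar (Suc m) ^ e :: 'a mpol)"
        using expo_snoc[of e 0 m q] e that by (simp add: mvar_power mon_add)
      show ?thesis
        unfolding eq split_root_eq using iv by (simp only: pr_mult pr_power in_vars_power)
    qed
    then show "map (\<lambda>x. x \<otimes>\<^bsub>T\<^esub> split_root n f (Suc m) [^]\<^bsub>T\<^esub> e) (basis_seq n f m)
        = map (\<lambda>q. pr (mon (expo 0 (Suc m) (e * ?L + q)))) [0..<?L]"
      using Suc by simp
  qed simp
  also have "\<dots> = map (\<lambda>q. pr (mon (expo 0 (Suc m) q))) [0..<(n - m) * ?L]"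
    by (rule concat_map_upt[where h = "\<lambda>q. pr (mon (expo 0 (Suc m) q))"])
  also have "(n - m) * ?L = (\<Prod>i<Suc m. n - i)"
    by (simp add: mult.commute)
  finally show ?case .
qed

lemma R_basis_eq: "R_basis n f = map (\<lambda>q. pr (bas 0 q)) [0..<fact n]"
proof -
  define m where "m = n - 1"
  then have m: "Suc m = n" "m \<le> n" "n - 1 = m" "n - m = 1"
    using n_pos by auto
  have "(\<Prod>i<Suc m. n - i) = fact n"
    using fact_prod_rev[of n, where ?'a = nat] by (simp only: m atLeast0LessThan of_nat_id)
  then have L: "(\<Prod>i<m. n - i) = fact n"
    by (simp add: m(4))
  \<comment> \<open>The last digit has radix 1 and is always 0, so \<open>n - 1\<close> digits give
    the same monomial as \<open>n\<close> digits.\<close>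
  have "expo 0 n q = expo 0 m q" if "q < fact n" for q
    using expo_snoc[of 0 0 m q] that L m by simp
  then show ?thesis
    unfolding R_basis_def m(3) basis_seq_eq[OF m(2)] L by (simp add: bas_def)
qed

lemma S_basis_set_eq:
  "S_basis_set n f = {pr (mon (sum_list (map (\<lambda>i. Poly_Mapping.single i (\<alpha> i)) [2..<Suc n]))) |\<alpha>.
     \<forall>i\<in>{2..n}. \<alpha> i \<le> n - i}"
proof -
  interpret ring T by (rule ring_T)
  have iv: "set xs \<subseteq> {1..n} \<Longrightarrow> iv (mon (sum_list (map (\<lambda>i. Poly_Mapping.single i (\<alpha> i)) xs)))"
    for xs and \<alpha> :: "nat \<Rightarrow> nat"
  proof (induction xs)
    case (Cons i xs)
    then show ?case
      using in_vars_power[OF iv_mvar[of i], of "\<alpha> i"] by (auto simp: mon_add mvar_power)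
  qed simp
  have "foldr (\<lambda>i y. (split_root n f i [^]\<^bsub>T\<^esub> \<alpha> i) \<otimes>\<^bsub>T\<^esub> y) xs \<one>\<^bsub>T\<^esub>
      = pr (mon (sum_list (map (\<lambda>i. Poly_Mapping.single i (\<alpha> i)) xs)))"
    if "set xs \<subseteq> {1..n}" for xs and \<alpha> :: "nat \<Rightarrow> nat"
    using that
  proof (induction xs)
    case (Cons i xs)
    moreover have "pr (mvar i) [^]\<^bsub>T\<^esub> \<alpha> i = pr (mon (Poly_Mapping.single i (\<alpha> i)))"
      using Cons.prems pr_power[of "mvar i" "\<alpha> i"] by (simp add: mvar_power)
    ultimately show ?case
      using pr_mult[OF in_vars_power[OF iv_mvar[of i], of "\<alpha> i"] iv[of xs \<alpha>]]
      by (simp add: split_root_eq mon_add mvar_power)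
  qed (simp add: pr_1)
  moreover have "set [2..<Suc n] \<subseteq> {1..n}" by auto
  ultimately show ?thesis
    unfolding S_basis_set_def by simp
qed

text \<open>The lowest digit \<open>q mod n\<close> is the exponent of the first root, and distinct
  bounded monomials have distinct classes.\<close>

lemma bas_in_S_basis_set_iff:
  assumes "n > 1"
  shows "pr (bas 0 q) \<in> S_basis_set n f \<longleftrightarrow> q mod n = 0"
proof
  let ?s = "\<lambda>\<alpha>. sum_list (map (\<lambda>i. Poly_Mapping.single i (\<alpha> i)) [2..<Suc n]) :: nat \<Rightarrow>\<^sub>0 nat"
  have lk: "Poly_Mapping.lookup (?s \<alpha>) i = (if i \<in> {2..n} then \<alpha> i else 0)" for \<alpha> i
    by (subst lookup_sum_list_single) auto
  have e1: "Poly_Mapping.lookup (expo 0 n q) 1 = q mod n"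
    using lookup_expo_Suc[of n 0 q] n_pos by (simp add: One_nat_def)
  show "q mod n = 0" if in_S: "pr (bas 0 q) \<in> S_basis_set n f"
  proof -
    obtain \<alpha> where \<alpha>: "pr (bas 0 q) = pr (mon (?s \<alpha>))" "\<forall>i\<in>{2..n}. \<alpha> i \<le> n - i"
      using in_S unfolding S_basis_set_eq by blast
    have "\<alpha> (Suc k) < n - k" if "2 \<le> Suc k" "Suc k \<le> n" for k
      using \<alpha>(2)[rule_format, of "Suc k"] that by auto
    then have b: "bounded (?s \<alpha>)"
      unfolding bounded_def lk using n_pos by auto
    have "Poly_Mapping.keys (?s \<alpha>) \<subseteq> {1..n}"
      by (auto simp: in_keys_iff lk simp del: upt_Suc split: if_splits)
    then have "iv (mon (?s \<alpha>))"
      by (rule in_vars_single)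
    then have "expo 0 n q = ?s \<alpha>"
      using \<alpha>(1) by (intro mon_congr_unique bounded_expo b) (simp add: pr_eq_iff bas_def iv_expo)
    then show ?thesis
      using e1 lk[of \<alpha> 1] by simp
  qed
  show "pr (bas 0 q) \<in> S_basis_set n f" if q: "q mod n = 0"
  proof -
    let ?\<alpha> = "Poly_Mapping.lookup (expo 0 n q)"
    have e: "expo 0 n q = ?s ?\<alpha>"
    proof (rule poly_mapping_eqI)
      fix i
      consider "i = 0" | "i = 1" | "i \<in> {2..n}" | "i > n" by fastforce
      then show "?\<alpha> i = Poly_Mapping.lookup (?s ?\<alpha>) i"
        unfolding lk using assms q e1 lookup_expo_le[of 0 0] lookup_expo_gt[of 0 n i]
        by cases auto
    qed
    have "?\<alpha> i \<le> n - i" if "i \<in> {2..n}" for i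
      using that lookup_expo_less[of "i - 1" 0 n q] by (cases i) auto
    then show ?thesis
      unfolding S_basis_set_eq bas_def
      by (intro CollectI exI[of _ ?\<alpha>] conjI ballI) (simp_all only: diff_zero flip: e)
  qed
qed

text \<open>The indices with lowest digit 0 are the multiples \<open>p * n\<close> in increasing
  order, and the digits of \<open>p\<close> are the remaining exponents; this is the inherited
  order.\<close>

lemma S_basis_eq:
  assumes "n > 1"
  shows "S_basis n f = map (\<lambda>p. pr (bas 1 p)) [0..<fact (n - 1)]"
proof -
  have "S_basis n f = map (\<lambda>q. pr (bas 0 q)) (filter (\<lambda>q. q mod n = 0) [0..<fact n])"
    unfolding S_basis_def R_basis_eq
    by (simp add: filter_map o_def bas_in_S_basis_set_iff[OF assms])
  also have "filter (\<lambda>q. q mod n = 0) [0..<fact n] = map (\<lambda>p. p * n) [0..<fact (n - 1)]"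
    using filter_mod_upt[of n "fact (n - 1)"] fact_diff[of 0] n_pos by (simp add: One_nat_def)
  also have "map (\<lambda>q. pr (bas 0 q)) \<dots> = map (\<lambda>p. pr (bas 1 p)) [0..<fact (n - 1)]"
    using bas_mult_add[of 0 0] n_pos by (simp add: One_nat_def)
  finally show ?thesis .
qed

section \<open>Coordinates over R\<close>

lemma coords_R:
  assumes "iv x" "x \<doteq> (\<Sum>q<fact n. bas 0 q * mconst (c q))" "q < fact n"
  shows "coords T UNIV (emb n f) (R_basis n f) (pr x) q = c q"
proof -
  have len: "length (R_basis n f) = fact n" by (simp add: R_basis_eq)
  have sum: "(\<Oplus>\<^bsub>T\<^esub>j\<in>{..<fact n}. R_basis n f ! j \<otimes>\<^bsub>T\<^esub> emb n f (d j)) = pr (\<Sum>q<fact n. bas 0 q * mconst (d q))" for d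
  proof -
    interpret ring T by (rule ring_T)
    show ?thesis
      by (subst pr_sum, simp, rule finsum_cong') (auto simp: R_basis_eq emb_eq pr_mult)
  qed
  \<comment> \<open>Coordinate functions are extensional on the index set, hence the
    restriction.\<close>
  let ?c = "restrict c {..<fact n}"
  have "(THE d. d \<in> {..<fact n} \<rightarrow>\<^sub>E UNIV \<and> pr x = (\<Oplus>\<^bsub>T\<^esub>j\<in>{..<fact n}. R_basis n f ! j \<otimes>\<^bsub>T\<^esub> emb n f (d j))) = ?c"
  proof (rule the_equality)
    show "?c \<in> {..<fact n} \<rightarrow>\<^sub>E UNIV \<and> pr x = (\<Oplus>\<^bsub>T\<^esub>j\<in>{..<fact n}. R_basis n f ! j \<otimes>\<^bsub>T\<^esub> emb n f (?c j))"
      using assms(1,2) by (auto simp: sum pr_eq_iff)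
  next
    fix d assume d: "d \<in> {..<fact n} \<rightarrow>\<^sub>E UNIV \<and> pr x = (\<Oplus>\<^bsub>T\<^esub>j\<in>{..<fact n}. R_basis n f ! j \<otimes>\<^bsub>T\<^esub> emb n f (d j))"
    then have "x \<doteq> (\<Sum>q<fact n. bas 0 q * mconst (d q))"
      using assms(1) by (simp add: sum pr_eq_iff)
    then have "(\<Sum>q<fact n. bas 0 q * mconst (d q)) \<doteq> (\<Sum>q<fact n. bas 0 q * mconst (c q))"
      using assms(2) congr_trans congr_sym by blast
    then have "d q = c q" if "q < fact n" for q
      using that by (rule bas_congr_unique)
    then show "d = ?c"
      using d by (auto simp: PiE_def extensional_def restrict_def fun_eq_iff)
  qed
  then show ?thesis
    using assms(3) by (simp add: coords_def len)
qed

lemma A_mat_entry: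
  assumes "i \<in> {1..n}" "mvar i * bas 0 q \<doteq> (\<Sum>p<fact n. bas 0 p * mconst (c p))" "p < fact n" "q < fact n"
  shows "A_mat n f i $$ (p, q) = c p"
proof -
  have "split_root n f i \<otimes>\<^bsub>T\<^esub> R_basis n f ! q = pr (mvar i * bas 0 q)"
    using assms(1,4) by (simp add: R_basis_eq split_root_eq pr_mult del: atLeastAtMost_iff)
  then show ?thesis
    using assms coords_R[of "mvar i * bas 0 q" c p]
    by (simp add: A_mat_def left_mult_mat_def R_basis_eq del: atLeastAtMost_iff)
qed

lemma A_mat_carrier: "A_mat n f i \<in> carrier_mat (fact n) (fact n)"
  by (simp add: A_mat_def left_mult_mat_def R_basis_eq)

end


section \<open>The matrices over \<open>R\<close> and over \<open>R[r\<^sub>1]\<close>\<close>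

lemma diag_block_mat_replicate:
  assumes "C \<in> carrier_mat d d"
  shows "diag_block_mat (replicate m C) \<in> carrier_mat (m * d) (m * d)"
    and "p < m * d \<Longrightarrow> q < m * d \<Longrightarrow> diag_block_mat (replicate m C) $$ (p, q)
      = (if p div d = q div d then C $$ (p mod d, q mod d) else 0)"
proof -
  show carrier: "diag_block_mat (replicate m C) \<in> carrier_mat (m * d) (m * d)" for m
    using assms by (intro carrier_matI) (simp_all add: dim_diag_block_mat sum_list_replicate)
  show "p < m * d \<Longrightarrow> q < m * d \<Longrightarrow> diag_block_mat (replicate m C) $$ (p, q)
      = (if p div d = q div d then C $$ (p mod d, q mod d) else 0)"
  proof (induction m arbitrary: p q)
    case (Suc m)
    have d: "d > 0" using Suc.prems(1) by (cases d) auto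
    have dims: "dim_row C = d" "dim_col C = d" "dim_row (diag_block_mat (replicate m C)) = m * d"
      "dim_col (diag_block_mat (replicate m C)) = m * d"
      using assms carrier[of m] by auto
    have "diag_block_mat (replicate (Suc m) C) $$ (p, q)
        = (if p < d then if q < d then C $$ (p, q) else 0
           else if q < d then 0 else diag_block_mat (replicate m C) $$ (p - d, q - d))"
      using Suc.prems by (auto simp: Let_def dims)
    also have "\<dots> = (if p div d = q div d then C $$ (p mod d, q mod d) else 0)"
    proof (cases "p < d \<or> q < d")
      case True
      then show ?thesis
        using d by (auto simp: div_eq_0_iff dest: sym)
    next
      case False
      then have "p div d = Suc ((p - d) div d)" "q div d = Suc ((q - d) div d)"
        "p mod d = (p - d) mod d" "q mod d = (q - d) mod d"
        using d by (simp_all add: le_div_geq le_mod_geq)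
      moreover have "p - d < m * d" "q - d < m * d"
        using False Suc.prems by auto
      ultimately show ?thesis
        using False Suc.IH by simp
    qed
    finally show ?case .
  qed simp
qed

lemma mult_add_less: "p < m \<Longrightarrow> a < d \<Longrightarrow> p * d + a < m * d" for p :: nat
  by (metis add.commute add_less_cancel_left less_le_trans mult_Suc mult_le_mono1 Suc_leI)

text \<open>The shift is by \<open>j + 1\<close> because \<open>bracket f 0\<close> already drops
  the constant term.\<close>

lemma coeff_bracket: "Polynomial.coeff (bracket f j) k = Polynomial.coeff f (j + 1 + k)"
  by (induction j arbitrary: k) (simp_all add: coeff_poly_shift add_ac One_nat_def)

context central_monic
begin

section \<open>Evaluation at the first root and at the companion matrix\<close>

abbreviation X1 :: "'a mpol" where "X1 \<equiv> mvar 1"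

abbreviation C where "C \<equiv> companion n f"

lemma companion_carrier [simp]: "C \<in> carrier_mat n n"
  by (simp add: companion_def)

lemma companion_entry_0: "a < n \<Longrightarrow> t < n \<Longrightarrow> companion_entry 0 a t = mconst (C $$ (a, t))"
  by (simp add: companion_entry_def companion_def mconst_simps)

lemma X1_mult_power: "t < n \<Longrightarrow> X1 * X1 ^ t \<doteq> (\<Sum>a<n. X1 ^ a * mconst (C $$ (a, t)))"
  using mvar_mult_power[of 0 t] n_pos by (simp add: companion_entry_0 One_nat_def)

text \<open>With scalars on the right, composing left multiplications multiplies their
  matrices.\<close>

lemma X1_power_mult_power: "t < n \<Longrightarrow> X1 ^ k * X1 ^ t \<doteq> (\<Sum>a<n. X1 ^ a * mconst ((C ^\<^sub>m k) $$ (a, t)))"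
proof (induction k arbitrary: t)
  case 0
  have "(\<Sum>a<n. X1 ^ a * mconst ((C ^\<^sub>m 0) $$ (a, t))) = (\<Sum>a<n. if a = t then X1 ^ a else 0)"
    by (rule sum.cong) (use 0 in \<open>auto simp: mconst_simps companion_def\<close>)
  then show ?case using 0 by (simp add: congr_refl)
next
  case (Suc k)
  have pow: "C ^\<^sub>m k \<in> carrier_mat n n" by (simp add: pow_carrier_mat)
  \<comment> \<open>The single factor acts first, which matches the unfolding of
    \<open>C ^\<^sub>m Suc k\<close> with \<open>C\<close> as right factor.\<close>
  have "X1 ^ Suc k * X1 ^ t = X1 ^ k * (X1 * X1 ^ t)"
    by (simp only: power_Suc2 mult.assoc)
  also have "\<dots> \<doteq> X1 ^ k * (\<Sum>s<n. X1 ^ s * mconst (C $$ (s, t)))"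
    using Suc.prems by (intro congr_multL X1_mult_power)
  also have "\<dots> = (\<Sum>s<n. X1 ^ k * X1 ^ s * mconst (C $$ (s, t)))"
    by (simp add: sum_distrib_left mult.assoc)
  also have "\<dots> \<doteq> (\<Sum>s<n. (\<Sum>a<n. X1 ^ a * mconst ((C ^\<^sub>m k) $$ (a, s))) * mconst (C $$ (s, t)))"
    by (intro congr_sum congr_multR Suc.IH) simp
  also have "\<dots> = (\<Sum>a<n. X1 ^ a * mconst (\<Sum>s<n. (C ^\<^sub>m k) $$ (a, s) * C $$ (s, t)))"
    unfolding mconst_sum mconst_simps sum_distrib_left sum_distrib_right
    by (subst sum.swap) (simp add: mult.assoc)
  also have "\<dots> = (\<Sum>a<n. X1 ^ a * mconst ((C ^\<^sub>m Suc k) $$ (a, t)))"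
  proof (rule sum.cong)
    fix a assume "a \<in> {..<n}"
    then have "(C ^\<^sub>m Suc k) $$ (a, t) = (\<Sum>s<n. (C ^\<^sub>m k) $$ (a, s) * C $$ (s, t))"
      using pow Suc.prems companion_carrier
      by (simp add: scalar_prod_def atLeast0LessThan del: companion_carrier)
    then show "X1 ^ a * mconst (\<Sum>s<n. (C ^\<^sub>m k) $$ (a, s) * C $$ (s, t)) = X1 ^ a * mconst ((C ^\<^sub>m Suc k) $$ (a, t))"
      by simp
  qed simp
  finally show ?case .
qed

definition eval_X1 :: "'a poly \<Rightarrow> 'a mpol" where
  "eval_X1 p = (\<Sum>k\<le>Polynomial.degree p. mconst (Polynomial.coeff p k) * X1 ^ k)"

text \<open>The coefficients of \<open>p\<close> move past the central powers of \<open>X1\<close>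
  and end up on the left of the matrix entries, as in \<open>eval_mat\<close>.\<close>

lemma eval_X1_mult_power:
  assumes "t < n"
  shows "eval_X1 p * X1 ^ t \<doteq> (\<Sum>a<n. X1 ^ a * mconst (eval_mat p C $$ (a, t)))"
proof -
  have cp: "central (X1 ^ a)" for a by simp
  have "eval_X1 p * X1 ^ t = (\<Sum>k\<le>Polynomial.degree p. mconst (Polynomial.coeff p k) * (X1 ^ k * X1 ^ t))"
    by (simp add: eval_X1_def sum_distrib_right mult.assoc)
  also have "\<dots> \<doteq> (\<Sum>k\<le>Polynomial.degree p. mconst (Polynomial.coeff p k) * (\<Sum>a<n. X1 ^ a * mconst ((C ^\<^sub>m k) $$ (a, t))))"
    by (intro congr_sum congr_multL X1_power_mult_power assms)
  also have "\<dots> = (\<Sum>a<n. X1 ^ a * mconst (\<Sum>k\<le>Polynomial.degree p. Polynomial.coeff p k * (C ^\<^sub>m k) $$ (a, t)))"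
    unfolding mconst_sum mconst_simps sum_distrib_left
    by (subst sum.swap) (simp add: central_left_commute[OF cp, of "mconst _"])
  also have "\<dots> = (\<Sum>a<n. X1 ^ a * mconst (eval_mat p C $$ (a, t)))"
    using assms by (simp add: eval_mat_def companion_def)
  finally show ?thesis .
qed

lemma iv_X1 [simp]: "iv X1"
  using n_pos by simp

lemma eval_split_eq: "eval_split n f p (split_root n f 1) = pr (eval_X1 p)"
proof -
  interpret ring T by (rule ring_T)
  show ?thesis
    unfolding eval_split_def eval_X1_def
    by (subst pr_sum, simp, rule finsum_cong') (auto simp: split_root_eq emb_eq pr_mult pr_power)
qed

text \<open>Identifies the coefficients of \<open>g = g\<^sub>1\<close> with the elements
  \<open>f\<^sup>[\<^sup>j\<^sup>](r\<^sub>1)\<close> before passing to the quotient.\<close>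

lemma G_1_eq: "G 1 j = eval_X1 (bracket f j)"
proof -
  let ?h = "\<lambda>k. mconst (Polynomial.coeff f (j + 1 + k)) * X1 ^ k"
  let ?d = "Polynomial.degree (bracket f j)"
  have "G 1 j = sum ?h {..<n}"
    by (simp add: One_nat_def G.simps(2))
  \<comment> \<open>A common range containing both the fixed bound of \<open>G\<close> and the
    degree bound of the evaluation.\<close>
  also have "\<dots> = sum ?h {..n + ?d}"
    by (rule sum.mono_neutral_left) (use deg_f in \<open>auto simp: Polynomial.coeff_eq_0 mconst_simps\<close>)
  also have "\<dots> = sum ?h {..?d}"
    by (rule sum.mono_neutral_right)
      (auto simp: mconst_simps simp flip: coeff_bracket intro!: Polynomial.le_degree)
  finally show ?thesis by (simp add: eval_X1_def coeff_bracket)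
qed

text \<open>The product \<open>G 1 j * X1 ^ t\<close> has two expansions, one through the matrix
  polynomial and one through \<open>bracket_entry\<close>; uniqueness of coefficients equates them
  without computing any power of \<open>C\<close>.\<close>

lemma eval_mat_bracket:
  assumes "a < n" "t < n"
  shows "eval_mat (bracket f j) C $$ (a, t)
    = (if t \<le> j then (if t \<le> a then Polynomial.coeff f (j + 1 + a - t) else 0)
       else (if a < t \<and> t \<le> a + j + 1 then - Polynomial.coeff f (a + j + 1 - t) else 0))" (is "_ = ?b a")
proof -
  have bracket_entry: "bracket_entry 0 j a t = mconst (?b a)" for a
    by (simp add: bracket_entry_def mconst_simps)
  have "(\<Sum>a<n. X1 ^ a * mconst (eval_mat (bracket f j) C $$ (a, t))) \<doteq> G 1 j * X1 ^ t"
    unfolding G_1_eq by (rule congr_sym, rule eval_X1_mult_power) (rule assms)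
  also have "G 1 j * X1 ^ t \<doteq> (\<Sum>a<n. X1 ^ a * mconst (?b a))"
    using G_Suc_mult_power[of 0 t j] assms n_pos by (simp add: One_nat_def bracket_entry)
  finally show ?thesis
    using assms(1) by (rule mult_power_congr_unique)
qed

section \<open>The subring generated by R and the first root\<close>

definition lin :: "(nat \<Rightarrow> 'a) \<Rightarrow> 'a mpol" where
  "lin d = (\<Sum>a<n. X1 ^ a * mconst (d a))"

definition S_span :: "'a mpol set" where
  "S_span = {x. iv x \<and> (\<exists>d. x \<doteq> lin d)}"

lemma iv_lin [simp]: "iv (lin d)"
  unfolding lin_def by (intro in_vars_sum in_vars_mult in_vars_power) auto

lemma S_span_0: "0 \<in> S_span"
  unfolding S_span_def lin_def by (auto intro!: exI[of _ "\<lambda>_. 0"] simp: mconst_simps congr_refl)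

lemma S_span_add: "x \<in> S_span \<Longrightarrow> y \<in> S_span \<Longrightarrow> x + y \<in> S_span"
proof -
  assume "x \<in> S_span" "y \<in> S_span"
  then obtain d e where "iv x" "iv y" "x \<doteq> lin d" "y \<doteq> lin e"
    unfolding S_span_def by blast
  moreover have "lin d + lin e = lin (\<lambda>a. d a + e a)"
    by (simp add: lin_def mconst_simps distrib_left sum.distrib)
  ultimately show ?thesis
    unfolding S_span_def using congr_add[of x "lin d" y "lin e"] by auto
qed

lemma S_span_sum: "(\<And>i. i \<in> A \<Longrightarrow> g i \<in> S_span) \<Longrightarrow> sum g A \<in> S_span"
  by (induction A rule: infinite_finite_induct) (auto simp: S_span_0 S_span_add)

lemma S_span_const_mult: "x \<in> S_span \<Longrightarrow> mconst a * x \<in> S_span"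
proof -
  assume "x \<in> S_span"
  then obtain d where x: "iv x" "x \<doteq> lin d"
    unfolding S_span_def by blast
  have cp: "central (X1 ^ i)" for i by simp
  have "mconst a * lin d = lin (\<lambda>i. a * d i)"
    by (simp add: lin_def mconst_simps sum_distrib_left central_left_commute[OF cp, of "mconst _"])
  then show ?thesis
    unfolding S_span_def using x congr_multL[of x "lin d" "mconst a"] by auto
qed

lemma S_span_congr: "x \<in> S_span \<Longrightarrow> iv y \<Longrightarrow> y \<doteq> x \<Longrightarrow> y \<in> S_span"
  unfolding S_span_def using congr_trans by blast

lemma S_span_X1_mult: "x \<in> S_span \<Longrightarrow> X1 * x \<in> S_span"
proof -
  assume "x \<in> S_span"
  then obtain d where x: "iv x" "x \<doteq> lin d"
    unfolding S_span_def by blast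
  have "X1 * x \<doteq> X1 * lin d"
    by (intro congr_multL x(2))
  also have "X1 * lin d = (\<Sum>t<n. X1 * X1 ^ t * mconst (d t))"
    by (simp add: lin_def sum_distrib_left mult.assoc)
  also have "\<dots> \<doteq> (\<Sum>t<n. (\<Sum>a<n. X1 ^ a * mconst (C $$ (a, t))) * mconst (d t))"
    by (intro congr_sum congr_multR X1_mult_power) simp
  also have "\<dots> = lin (\<lambda>a. \<Sum>t<n. C $$ (a, t) * d t)"
    unfolding lin_def mconst_sum mconst_simps sum_distrib_left sum_distrib_right
    by (subst sum.swap) (simp add: mult.assoc)
  finally show ?thesis
    unfolding S_span_def using x(1) by auto
qed

text \<open>Modulo \<open>J\<close> the left factor is built from constants and powers of
  \<open>X1\<close>, and left multiplication by either preserves the span.\<close>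

lemma S_span_mult: "x \<in> S_span \<Longrightarrow> y \<in> S_span \<Longrightarrow> x * y \<in> S_span"
proof -
  assume "x \<in> S_span" and y: "y \<in> S_span"
  then obtain d where x: "iv x" "x \<doteq> lin d"
    unfolding S_span_def by blast
  have pow: "z \<in> S_span \<Longrightarrow> X1 ^ a * z \<in> S_span" for a z
    by (induction a) (auto simp: mult.assoc S_span_X1_mult)
  have "lin d * y = (\<Sum>a<n. X1 ^ a * (mconst (d a) * y))"
    by (simp add: lin_def sum_distrib_right mult.assoc)
  also have "\<dots> \<in> S_span"
    by (intro S_span_sum pow S_span_const_mult y)
  finally show ?thesis
    by (rule S_span_congr) (use x y in \<open>auto simp: S_span_def intro: congr_multR\<close>)
qed

lemma S_span_1: "1 \<in> S_span"
proof -
  have "lin (\<lambda>a. if a = 0 then 1 else 0) = (\<Sum>a<n. if a = 0 then 1 else 0)"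
    unfolding lin_def by (rule sum.cong) (auto simp: mconst_simps)
  then have "1 = lin (\<lambda>a. if a = 0 then 1 else 0)"
    using n_pos by simp
  then show ?thesis
    unfolding S_span_def using congr_refl by (metis (mono_tags, lifting) in_vars_1 mem_Collect_eq)
qed

text \<open>The span is closed under the ring operations and contains the generators; conversely
  each combination of powers of the first root lies in the generated ring.\<close>

lemma S_ring_eq: "S_ring n f = pr ` S_span"
proof
  show "S_ring n f \<subseteq> pr ` S_span"
  proof
    fix y assume "y \<in> S_ring n f"
    then have "y \<in> generate_ring T (insert (pr X1) (range (\<lambda>a. pr (mconst a))))"
      by (simp add: S_ring_def split_root_eq emb_eq)
    then show "y \<in> pr ` S_span"
    proof (induction rule: generate_ring.induct)
      case one
      then show ?case using S_span_1 pr_1 by (metis image_eqI)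
    next
      case (incl h)
      have "X1 \<in> S_span" using S_span_X1_mult[OF S_span_1] by simp
      moreover have "mconst a \<in> S_span" for a using S_span_const_mult[OF S_span_1, of a] by simp
      ultimately show ?case using incl by auto
    next
      case (a_inv h)
      then obtain x where x: "x \<in> S_span" "h = pr x" by blast
      have "- x \<in> S_span" using S_span_const_mult[OF x(1), of "- 1"] by (simp add: mconst_simps)
      then show ?case using x by (auto simp: S_span_def simp flip: pr_uminus)
    next
      case (eng_add h1 h2)
      then obtain x y where xy: "x \<in> S_span" "y \<in> S_span" "h1 = pr x" "h2 = pr y" by blast
      then have "h1 \<oplus>\<^bsub>T\<^esub> h2 = pr (x + y)" by (simp add: S_span_def pr_add)
      then show ?case using xy S_span_add by blast
    next
      case (eng_mult h1 h2)
      then obtain x y where xy: "x \<in> S_span" "y \<in> S_span" "h1 = pr x" "h2 = pr y" by blast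
      then have "h1 \<otimes>\<^bsub>T\<^esub> h2 = pr (x * y)" by (simp add: S_span_def pr_mult)
      then show ?case using xy S_span_mult by blast
    qed
  qed
  interpret ring T by (rule ring_T)
  let ?H = "insert (split_root n f 1) (range (emb n f))"
  have H: "?H \<subseteq> carrier T"
    by (auto simp: split_root_eq emb_eq)
  have sub: "subring (S_ring n f) T"
    unfolding S_ring_def by (rule generate_ring_is_subring[OF H])
  have const: "pr (mconst a) \<in> S_ring n f" and root: "pr X1 \<in> S_ring n f" for a
    unfolding S_ring_def by (auto intro!: generate_ring.incl simp: split_root_eq emb_eq)
  have pow: "pr (X1 ^ i) \<in> S_ring n f" for i
    by (induction i) (auto simp: pr_1 pr_mult root subringE(3,6)[OF sub])
  have "pr (\<Sum>a\<in>A. X1 ^ a * mconst (d a)) \<in> S_ring n f" for A d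
    by (induction A rule: infinite_finite_induct)
      (auto simp: pr_0 pr_add pr_mult pow const subringE(2,6,7)[OF sub])
  then have lin: "pr (lin d) \<in> S_ring n f" for d
    by (simp add: lin_def)
  show "pr ` S_span \<subseteq> S_ring n f"
  proof (rule image_subsetI)
    fix x assume "x \<in> S_span"
    then obtain d where "iv x" "x \<doteq> lin d"
      unfolding S_span_def by blast
    then have "pr x = pr (lin d)"
      by (simp add: pr_eq_iff)
    then show "pr x \<in> S_ring n f"
      using lin by simp
  qed
qed

lemma coeffs_pm_in_S_span:
  assumes "x \<in> coeffs_pm 1"
  shows "x \<in> S_span"
proof -
  have "eval_X1 p \<in> S_span" for p
    unfolding eval_X1_def
  proof (intro S_span_sum S_span_const_mult)
    show "X1 ^ k \<in> S_span" for k
      by (induction k) (auto simp: S_span_1 S_span_X1_mult)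
  qed
  then have "G 1 j \<in> S_span" for j
    by (simp add: G_1_eq)
  moreover from this have "- G 1 j \<in> S_span" for j
    using S_span_const_mult[of "G 1 j" "- 1"] by (simp add: mconst_simps)
  ultimately show ?thesis
    using assms unfolding coeffs_pm_def by auto
qed

section \<open>Coordinates over the extension by the first root\<close>

lemma sum_bas_lin:
  "(\<Sum>p<fact (n - 1). bas 1 p * lin (d p)) = (\<Sum>q<fact n. bas 0 q * mconst (d (q div n) (q mod n)))"
proof -
  have N: "fact n = fact (n - 1) * n"
    using fact_diff[of 0] n_pos by (simp add: One_nat_def)
  have cp: "central (X1 ^ a)" for a by simp
  have bas: "a < n \<Longrightarrow> bas 0 (p * n + a) = bas 1 p * X1 ^ a" for a p
    using bas_mult_add[of 0 a p] n_pos centralD[OF cp[of a]] by (simp add: One_nat_def)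
  have "(\<Sum>q<fact n. bas 0 q * mconst (d (q div n) (q mod n)))
      = (\<Sum>p<fact (n - 1). \<Sum>a<n. bas 1 p * X1 ^ a * mconst (d p a))"
    unfolding N sum_mult_lessThan by (simp add: bas)
  then show ?thesis
    by (simp add: lin_def sum_distrib_left mult.assoc)
qed

text \<open>Uniqueness over \<open>S\<close> follows from uniqueness over \<open>R\<close>:
  expanding all coordinates in powers of the first root turns an \<open>S\<close>-combination into
  an \<open>R\<close>-combination of the full basis.\<close>

lemma coords_S:
  assumes "n > 1" "iv x" "x \<doteq> (\<Sum>p<fact (n - 1). bas 1 p * e p)"
    and e: "\<And>p. e p \<in> S_span" and "p < fact (n - 1)"
  shows "coords T (S_ring n f) (\<lambda>s. s) (S_basis n f) (pr x) p = pr (e p)"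
proof -
  let ?N = "fact (n - 1)"
  interpret ring T by (rule ring_T)
  have len: "length (S_basis n f) = ?N" by (simp add: S_basis_eq[OF assms(1)])
  have sum: "(\<Oplus>\<^bsub>T\<^esub>j\<in>{..<?N}. S_basis n f ! j \<otimes>\<^bsub>T\<^esub> c j) = pr (\<Sum>p<?N. bas 1 p * g p)"
    if "\<And>p. p < ?N \<Longrightarrow> iv (g p)" "\<And>p. p < ?N \<Longrightarrow> c p = pr (g p)" for c g
    by (subst pr_sum, use that n_pos in simp, rule finsum_cong')
      (use that n_pos in \<open>auto simp: S_basis_eq[OF assms(1)] pr_mult\<close>)
  have ive: "iv (e p)" for p using e by (simp add: S_span_def)
  have "\<forall>p. \<exists>d. e p \<doteq> lin d" using e by (auto simp: S_span_def)
  from choice[OF this] obtain d where d: "\<And>p. e p \<doteq> lin (d p)" by blast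
  let ?c = "restrict (\<lambda>p. pr (e p)) {..<?N}"
  have "(THE c. c \<in> {..<?N} \<rightarrow>\<^sub>E S_ring n f \<and> pr x = (\<Oplus>\<^bsub>T\<^esub>j\<in>{..<?N}. S_basis n f ! j \<otimes>\<^bsub>T\<^esub> c j)) = ?c"
  proof (rule the_equality)
    have "pr x = pr (\<Sum>p<?N. bas 1 p * e p)"
      using assms(2,3) ive n_pos by (simp add: pr_eq_iff)
    also have "\<dots> = (\<Oplus>\<^bsub>T\<^esub>j\<in>{..<?N}. S_basis n f ! j \<otimes>\<^bsub>T\<^esub> ?c j)"
      by (rule sum[symmetric]) (simp_all add: ive)
    finally show "?c \<in> {..<?N} \<rightarrow>\<^sub>E S_ring n f \<and> pr x = (\<Oplus>\<^bsub>T\<^esub>j\<in>{..<?N}. S_basis n f ! j \<otimes>\<^bsub>T\<^esub> ?c j)"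
      using e by (auto simp: S_ring_eq)
  next
    fix c assume c: "c \<in> {..<?N} \<rightarrow>\<^sub>E S_ring n f \<and> pr x = (\<Oplus>\<^bsub>T\<^esub>j\<in>{..<?N}. S_basis n f ! j \<otimes>\<^bsub>T\<^esub> c j)"
    have "\<exists>d. p < ?N \<longrightarrow> c p = pr (lin d)" for p
    proof (cases "p < ?N")
      case True
      then have "c p \<in> pr ` S_span"
        using c by (auto simp: S_ring_eq PiE_iff)
      then obtain y where "y \<in> S_span" "c p = pr y" by blast
      then show ?thesis by (auto simp: S_span_def pr_eq_iff)
    qed simp
    then have "\<forall>p. \<exists>d. p < ?N \<longrightarrow> c p = pr (lin d)" by blast
    from choice[OF this] obtain d' where d': "\<And>p. p < ?N \<Longrightarrow> c p = pr (lin (d' p))" by blast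
    have "pr x = pr (\<Sum>p<?N. bas 1 p * lin (d' p))"
      using c sum[of "\<lambda>p. lin (d' p)" c] d' by simp
    then have "(\<Sum>p<?N. bas 1 p * lin (d' p)) \<doteq> x"
      using assms(2) n_pos congr_sym by (simp add: pr_eq_iff)
    also note assms(3)
    also have "(\<Sum>p<?N. bas 1 p * e p) \<doteq> (\<Sum>p<?N. bas 1 p * lin (d p))"
      by (intro congr_sum congr_multL d)
    finally have *: "d' (q div n) (q mod n) = d (q div n) (q mod n)" if "q < fact n" for q
      unfolding sum_bas_lin using that by (rule bas_congr_unique)
    have "c p = pr (e p)" if p: "p < ?N" for p
    proof -
      have "d' p a = d p a" if "a < n" for a
        using *[of "p * n + a"] mult_add_less[OF p that] that fact_diff[of 0] n_pos
        by (simp add: One_nat_def)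
      then have "lin (d' p) = lin (d p)"
        unfolding lin_def by (intro sum.cong) auto
      then show ?thesis
        using d'[OF p] d[of p] ive congr_sym by (simp add: pr_eq_iff)
    qed
    then show "c = ?c"
      using c by (auto simp: PiE_def extensional_def restrict_def fun_eq_iff)
  qed
  then show ?thesis
    using assms(5) by (simp add: coords_def len)
qed

lemma B_mat_entry:
  assumes "n > 1" "i \<in> {1..n}" "mvar i * bas 1 q \<doteq> (\<Sum>p<fact (n - 1). bas 1 p * e p)"
    "\<And>p. e p \<in> S_span" "p < fact (n - 1)" "q < fact (n - 1)"
  shows "B_mat n f i $$ (p, q) = pr (e p)"
proof -
  have "split_root n f i \<otimes>\<^bsub>T\<^esub> S_basis n f ! q = pr (mvar i * bas 1 q)"
    using assms(1,2,6) by (simp add: S_basis_eq split_root_eq pr_mult del: atLeastAtMost_iff)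
  then show ?thesis
    using assms coords_S[of "mvar i * bas 1 q" e p]
    by (simp add: B_mat_def left_mult_mat_def S_basis_eq del: atLeastAtMost_iff)
qed

lemma B_mat_carrier: "n > 1 \<Longrightarrow> B_mat n f i \<in> carrier_mat (fact (n - 1)) (fact (n - 1))"
  by (simp add: B_mat_def left_mult_mat_def S_basis_eq)

section \<open>Entries and blocks of the matrices\<close>

lemma coeffs_pm_0_iff:
  "x \<in> coeffs_pm 0 \<longleftrightarrow> (\<exists>j. x = mconst (Polynomial.coeff f j) \<or> x = mconst (- Polynomial.coeff f j))"
  by (auto simp: coeffs_pm_def mconst_simps)

lemma A_mat_entry_coeff:
  assumes "i \<in> {1..n}" "p < fact n" "q < fact n" "A_mat n f i $$ (p, q) \<noteq> 0"
  shows "\<exists>k\<le>n. A_mat n f i $$ (p, q) = Polynomial.coeff f k \<or> A_mat n f i $$ (p, q) = - Polynomial.coeff f k"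
proof -
  obtain e where e: "range e \<subseteq> coeffs_pm 0" "mvar i * bas 0 q \<doteq> (\<Sum>p<fact n. bas 0 p * e p)"
    using mvar_mult_bas[of 0 i q] assms(1,3) by (auto simp: One_nat_def)
  have "\<forall>p. \<exists>c. e p = mconst c \<and> (\<exists>j. c = Polynomial.coeff f j \<or> c = - Polynomial.coeff f j)"
    using e(1) by (fastforce simp: coeffs_pm_0_iff)
  from choice[OF this] obtain c where c: "\<And>p. e p = mconst (c p)"
    "\<And>p. \<exists>j. c p = Polynomial.coeff f j \<or> c p = - Polynomial.coeff f j" by blast
  have "A_mat n f i $$ (p, q) = c p"
    using e(2) assms by (intro A_mat_entry) (simp_all add: c(1))
  moreover obtain j where "c p = Polynomial.coeff f j \<or> c p = - Polynomial.coeff f j"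
    using c(2) by blast
  \<comment> \<open>A non-zero entry comes from a non-zero coefficient of \<open>f\<close>, whose
    index is at most the degree \<open>n\<close>.\<close>
  ultimately show ?thesis
    using assms(4) deg_f Polynomial.le_degree[of f j] by (intro exI[of _ j]) auto
qed

lemma A_mat_1: "A_mat n f 1 = diag_block_mat (replicate (fact (n - 1)) C)"
proof (rule eq_matI)
  have N: "fact n = fact (n - 1) * n"
    using fact_diff[of 0] n_pos by (simp add: One_nat_def)
  have D: "diag_block_mat (replicate (fact (n - 1)) C) \<in> carrier_mat (fact n) (fact n)"
    unfolding N by (rule diag_block_mat_replicate(1)) simp
  show "dim_row (A_mat n f 1) = dim_row (diag_block_mat (replicate (fact (n - 1)) C))"
    "dim_col (A_mat n f 1) = dim_col (diag_block_mat (replicate (fact (n - 1)) C))"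
    using D A_mat_carrier[of 1] by auto
  fix p q assume "p < dim_row (diag_block_mat (replicate (fact (n - 1)) C))"
    "q < dim_col (diag_block_mat (replicate (fact (n - 1)) C))"
  then have pq: "p < fact n" "q < fact n" using D by auto
  have q: "q mod n < n" "q div n < fact (n - 1)"
    using pq(2) n_pos unfolding N by (auto simp: less_mult_imp_div_less)
  have "mvar 1 * bas 0 (q div n * n + q mod n)
      \<doteq> (\<Sum>p<fact n. bas 0 p * (if p div n = q div n then companion_entry 0 (p mod n) (q mod n) else 0))"
    using lift_block_X[of 0 "q mod n" "q div n"] n_pos q by (simp add: One_nat_def cong: if_cong)
  also have "\<dots> = (\<Sum>p<fact n. bas 0 p * mconst (if p div n = q div n then C $$ (p mod n, q mod n) else 0))"
    using n_pos q by (intro sum.cong) (auto simp: companion_entry_0 mconst_simps)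
  finally have "A_mat n f 1 $$ (p, q) = (if p div n = q div n then C $$ (p mod n, q mod n) else 0)"
    using pq n_pos by (intro A_mat_entry) simp_all
  then show "A_mat n f 1 $$ (p, q) = diag_block_mat (replicate (fact (n - 1)) C) $$ (p, q)"
    using pq unfolding N by (simp add: diag_block_mat_replicate(2)[OF companion_carrier])
qed

text \<open>An entry over \<open>S\<close> enters only through its action on the powers of the first
  root, and uniqueness of coefficients forces the block to be the matrix of this action.\<close>

lemma A_mat_block:
  assumes "i \<in> {2..n}" "q < fact (n - 1)" "p < fact (n - 1)"
    and e: "range e \<subseteq> coeffs_pm 1" "mvar i * bas 1 q \<doteq> (\<Sum>p<fact (n - 1). bas 1 p * e p)"
    and M: "M \<in> carrier_mat n n"
      "\<And>t. t < n \<Longrightarrow> e p * X1 ^ t \<doteq> (\<Sum>a<n. X1 ^ a * mconst (M $$ (a, t)))"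
  shows "mat_block n (A_mat n f i) p q = M"
proof (rule eq_matI)
  have N: "fact n = fact (n - 1) * n"
    using fact_diff[of 0] n_pos by (simp add: One_nat_def)
  show "dim_row (mat_block n (A_mat n f i) p q) = dim_row M"
    "dim_col (mat_block n (A_mat n f i) p q) = dim_col M"
    using M(1) by (auto simp: mat_block_def)
  fix a t assume "a < dim_row M" "t < dim_col M"
  then have at: "a < n" "t < n" using M(1) by auto
  \<comment> \<open>Lifting a column requires such an expansion for each of its entries, not only
    for the row in question.\<close>
  have "\<forall>p. \<exists>c. e p * X1 ^ t \<doteq> (\<Sum>a<n. X1 ^ a * mconst (c a))"
  proof
    fix p
    obtain c where c: "range c \<subseteq> coeffs_pm 0" "e p * X1 ^ t \<doteq> (\<Sum>a<n. X1 ^ a * c a)"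
      using coeffs_pm_mult_power[of 0 t "e p"] e(1) at n_pos by (auto simp: One_nat_def)
    have "\<forall>a. \<exists>b. c a = mconst b"
      using c(1) by (fastforce simp: coeffs_pm_0_iff)
    from choice[OF this] obtain b where "\<And>a. c a = mconst (b a)" by blast
    then show "\<exists>c. e p * X1 ^ t \<doteq> (\<Sum>a<n. X1 ^ a * mconst (c a))"
      using c(2) by auto
  qed
  from choice[OF this] obtain c where c: "\<And>p. e p * X1 ^ t \<doteq> (\<Sum>a<n. X1 ^ a * mconst (c p a))"
    by blast
  have "mvar i * bas 0 (q * n + t) \<doteq> (\<Sum>p<fact n. bas 0 p * mconst (c (p div n) (p mod n)))"
    using lift_block[of 0 t "mvar i" q e "\<lambda>p a. mconst (c p a)"] n_pos at e(2) c
    by (simp add: One_nat_def)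
  then have "A_mat n f i $$ (p * n + a, q * n + t) = c ((p * n + a) div n) ((p * n + a) mod n)"
    using assms(1-3) at mult_add_less unfolding N by (intro A_mat_entry) (auto simp: N)
  also have "\<dots> = c p a"
    using at by simp
  also have "\<dots> = M $$ (a, t)"
    by (rule mult_power_congr_unique[OF congr_trans[OF congr_sym[OF c] M(2)[OF at(2)]] at(1)])
  finally show "mat_block n (A_mat n f i) p q $$ (a, t) = M $$ (a, t)"
    using at by (simp add: mat_block_def)
qed

text \<open>The same element of \<open>S\<close> may arise from several \<open>j\<close> and signs.
  The replacement is therefore proved for every representation of the entry, through a congruence
  with the representative \<open>e p\<close>.\<close>

lemma B_mat_A_mat:
  assumes "n > 1" "i \<in> {2..n}" "p < fact (n - 1)" "q < fact (n - 1)"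
  shows "\<exists>j. B_mat n f i $$ (p, q) = pr (G 1 j) \<or> B_mat n f i $$ (p, q) = \<ominus>\<^bsub>T\<^esub> pr (G 1 j)"
    and "B_mat n f i $$ (p, q) = pr (G 1 j) \<Longrightarrow> mat_block n (A_mat n f i) p q = eval_mat (bracket f j) C"
    and "B_mat n f i $$ (p, q) = \<ominus>\<^bsub>T\<^esub> pr (G 1 j) \<Longrightarrow> mat_block n (A_mat n f i) p q = - eval_mat (bracket f j) C"
proof -
  obtain e where e: "range e \<subseteq> coeffs_pm 1" "mvar i * bas 1 q \<doteq> (\<Sum>p<fact (n - 1). bas 1 p * e p)"
    using mvar_mult_bas[of 1 i q] assms by (auto simp: One_nat_def)
  have S: "e p \<in> S_span" for p
    using e(1) by (auto intro: coeffs_pm_in_S_span)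
  have ive: "iv (e p)" using S by (simp add: S_span_def)
  have ivG: "iv (G 1 j)" for j using n_pos by simp
  have B: "B_mat n f i $$ (p, q) = pr (e p)"
    using assms S e(2) by (intro B_mat_entry) auto
  have "e p \<in> coeffs_pm 1" using e(1) by auto
  then obtain j' where "e p = G 1 j' \<or> e p = - G 1 j'"
    unfolding coeffs_pm_def by auto
  then show "\<exists>j. B_mat n f i $$ (p, q) = pr (G 1 j) \<or> B_mat n f i $$ (p, q) = \<ominus>\<^bsub>T\<^esub> pr (G 1 j)"
    unfolding B using pr_uminus[OF ivG] by auto
  have E: "eval_mat (bracket f j) C \<in> carrier_mat n n" for j
    by (simp add: eval_mat_def companion_def)
  show "mat_block n (A_mat n f i) p q = eval_mat (bracket f j) C" if "B_mat n f i $$ (p, q) = pr (G 1 j)"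
  proof (rule A_mat_block[OF assms(2,4,3) e E])
    have *: "e p \<doteq> G 1 j"
      using that ive ivG unfolding B by (simp add: pr_eq_iff)
    show "e p * X1 ^ t \<doteq> (\<Sum>a<n. X1 ^ a * mconst (eval_mat (bracket f j) C $$ (a, t)))" if "t < n" for t
      using congr_trans[OF congr_multR[OF *] eval_X1_mult_power[OF that, of "bracket f j", folded G_1_eq]] .
  qed
  show "mat_block n (A_mat n f i) p q = - eval_mat (bracket f j) C" if "B_mat n f i $$ (p, q) = \<ominus>\<^bsub>T\<^esub> pr (G 1 j)"
  proof (rule A_mat_block[OF assms(2,4,3) e])
    show "- eval_mat (bracket f j) C \<in> carrier_mat n n"
      using E by simp
    have *: "e p \<doteq> - G 1 j"
      using that ive ivG in_vars_uminus[OF ivG] unfolding B pr_uminus[OF ivG, symmetric] by (simp add: pr_eq_iff)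
    show "e p * X1 ^ t \<doteq> (\<Sum>a<n. X1 ^ a * mconst ((- eval_mat (bracket f j) C) $$ (a, t)))" if "t < n" for t
    proof -
      have "e p * X1 ^ t \<doteq> - G 1 j * X1 ^ t"
        by (rule congr_multR[OF *])
      also have "\<dots> \<doteq> - (\<Sum>a<n. X1 ^ a * mconst (eval_mat (bracket f j) C $$ (a, t)))"
        using congr_uminus[OF eval_X1_mult_power[OF that, of "bracket f j"]] by (simp add: G_1_eq)
      also have "\<dots> = (\<Sum>a<n. X1 ^ a * mconst ((- eval_mat (bracket f j) C) $$ (a, t)))"
        using E[of j] that by (simp add: sum_negf[symmetric] mconst_simps)
      finally show ?thesis .
    qed
  qed
qed

end

theorem theorem5p2:
  fixes f :: "'a::ring_1 poly" and n :: nat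
  assumes "n \<ge> 1"
    and "Polynomial.degree f = n"
    and "Polynomial.coeff f n = 1"
    and "\<forall>k<n. \<forall>x. Polynomial.coeff f k * x = x * Polynomial.coeff f k"
  shows
    "(\<forall>i\<in>{1..n}. A_mat n f i \<in> carrier_mat (fact n) (fact n)) \<and>
     A_mat n f 1 = diag_block_mat (replicate (fact (n - 1)) (companion n f)) \<and>
     (n = 1 \<longrightarrow> A_mat n f 1 = mat 1 1 (\<lambda>_. - Polynomial.coeff f 0)) \<and>
     (n > 1 \<longrightarrow>
       (\<forall>i\<in>{2..n}.
         B_mat n f i \<in> carrier_mat (fact (n - 1)) (fact (n - 1)) \<and>
         (\<forall>p<fact (n - 1). \<forall>q<fact (n - 1).
           (\<exists>j. B_mat n f i $$ (p, q) = eval_split n f (bracket f j) (split_root n f 1) \<or>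
                B_mat n f i $$ (p, q) =
                  \<ominus>\<^bsub>split_ring n f\<^esub> eval_split n f (bracket f j) (split_root n f 1)) \<and>
           (\<forall>j. (B_mat n f i $$ (p, q) = eval_split n f (bracket f j) (split_root n f 1) \<longrightarrow>
                  mat_block n (A_mat n f i) p q = eval_mat (bracket f j) (companion n f)) \<and>
                (B_mat n f i $$ (p, q) =
                  \<ominus>\<^bsub>split_ring n f\<^esub> eval_split n f (bracket f j) (split_root n f 1) \<longrightarrow>
                  mat_block n (A_mat n f i) p q = - eval_mat (bracket f j) (companion n f))))) \<and>
       (\<forall>j\<ge>n. eval_mat (bracket f j) (companion n f) = 0\<^sub>m n n) \<and>
       (\<forall>j\<le>n - 1. \<forall>r\<in>{1..n}. \<forall>c\<in>{1..n}.
         eval_mat (bracket f j) (companion n f) $$ (r - 1, c - 1) =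
           (if c \<le> j + 1
            then (if c \<le> r \<and> r \<le> n - 1 - j + c then Polynomial.coeff f (j + 1 + r - c) else 0)
            else (if c - 1 - j \<le> r \<and> r \<le> c - 1 then - Polynomial.coeff f (r + 1 + j - c) else 0)))) \<and>
     (\<forall>i\<in>{1..n}. \<forall>r<fact n. \<forall>c<fact n. A_mat n f i $$ (r, c) \<noteq> 0 \<longrightarrow>
       (\<exists>k\<le>n. A_mat n f i $$ (r, c) = Polynomial.coeff f k \<or>
               A_mat n f i $$ (r, c) = - Polynomial.coeff f k))"
proof -
  interpret central_monic n f
    using assms by unfold_locales (auto simp: central_def)
  have ev: "eval_split n f (bracket f j) (split_root n f 1) = pr (G 1 j)" for j
    by (simp add: eval_split_eq G_1_eq)
  have one: "A_mat n f 1 = mat 1 1 (\<lambda>_. - Polynomial.coeff f 0)" if "n = 1"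
  proof -
    have "A_mat n f 1 = C"
      unfolding A_mat_1 using that by (simp add: One_nat_def del: diag_block_mat.simps)
    then show ?thesis
      using that by (auto simp: companion_def intro!: eq_matI)
  qed
  have zero: "eval_mat (bracket f j) C = 0\<^sub>m n n" if "j \<ge> n" for j
  proof -
    have "bracket f j = 0"
      using that deg_f by (intro poly_eqI) (simp add: coeff_bracket Polynomial.coeff_eq_0)
    then show ?thesis by (auto simp: eval_mat_def companion_def intro!: eq_matI)
  qed
  have entry: "eval_mat (bracket f j) C $$ (r - 1, c - 1) =
      (if c \<le> j + 1
       then (if c \<le> r \<and> r \<le> n - 1 - j + c then Polynomial.coeff f (j + 1 + r - c) else 0)
       else (if c - 1 - j \<le> r \<and> r \<le> c - 1 then - Polynomial.coeff f (r + 1 + j - c) else 0))"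
    if "j \<le> n - 1" "r \<in> {1..n}" "c \<in> {1..n}" for j r c
  proof -
    obtain a t where [simp]: "r = Suc a" "c = Suc t"
      using \<open>r \<in> {1..n}\<close> \<open>c \<in> {1..n}\<close> by (cases r; cases c) auto
    have at: "a < n" "t < n" using that by auto
    \<comment> \<open>The upper bound on the row index excludes just the indices above
      \<open>n\<close>, where \<open>f\<close> has no coefficients.\<close>
    have "Polynomial.coeff f (j + 1 + a - t) = 0" if "t \<le> a" "\<not> a \<le> n - 1 - j + t"
      using that \<open>j \<le> n - 1\<close> n_pos deg_f by (intro Polynomial.coeff_eq_0) auto
    then show ?thesis
      using at by (auto simp: eval_mat_bracket[OF at] One_nat_def)
  qed
  show ?thesis
    unfolding ev
    apply (intro conjI impI ballI allI)
    subgoal by (rule A_mat_carrier)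
    subgoal by (rule A_mat_1)
    subgoal by (rule one)
    subgoal by (rule B_mat_carrier)
    subgoal by (rule B_mat_A_mat(1))
    subgoal by (rule B_mat_A_mat(2))
    subgoal by (rule B_mat_A_mat(3))
    subgoal by (rule zero)
    subgoal by (rule entry)
    subgoal by (rule A_mat_entry_coeff)
    done
qed

end
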